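(* Let $d\ge2$ be an integer, let $f:\mathcal{S}_d^{++}\to\mathbb{R}_+$ and $\widetilde f:\Sigma_d^{++}\to\mathbb{R}_+$ be probability density functions, and let $\delta\in(0,1)$. Then $$0\;\le\;1-\int_{\sqrt\delta}^{\infty}g_f\;\le\;m_f(\delta)\;\le\;1-\int_{I_d(\delta)}G_f\;\le\;1,$$ where $I_d(\delta):=(\sqrt\delta,+\infty)^d$. Furthermore, $$0\;\le\;1-\int_{\sqrt\delta}^{\infty}\widetilde g_{\widetilde f}\;\le\;\widetilde m_{\widetilde f}(\delta)\;\le\;1-\int_{\Delta_{d-1}(\delta)}\widetilde G_{\widetilde f}\;\le\;1,$$ where $$\Delta_{d-1}(\delta):=\left\{\boldsymbol{\beta}'\in(\mathbb{R}_{>0})^{d-1}:\ \beta_i'>\sqrt\delta\ \text{ for all } 1\le i\le d-1,\ \text{ and }\ \prod_{i=1}^{d-1}\beta_i'<\frac1{\sqrt\delta}\right\}.$$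
   Context: $\mathcal{S}_d^{++}$ is the set of real symmetric positive definite $d\times d$ matrices, and $\Sigma_d^{++}$ is the subset of those of determinant $1$. For $Q\in\mathcal{S}_d^{++}$, $M_d(Q):=\min_{\mathbf{a}\in\mathbb{Z}^d\setminus\{\mathbf{0}\}}{}^t\mathbf{a}\,Q\,\mathbf{a}$. Put $p:=d(d-1)/2$; $\lambda_k$ denotes $k$-dimensional Lebesgue measure. $\mathcal{S}_d^{++}$ is identified with an open subset of $\mathbb{R}^{p+d}$ via the upper triangular part of a matrix (diagonal included), and $\Sigma_d^{++}$ with a subset of $\mathbb{R}^{p+d-1}$ via the upper triangular part with the bottom right coefficient removed. Densities $f$ and $\widetilde f$ are taken with respect to $\lambda_{p+d}$ and $\lambda_{p+d-1}$ respectively under these identifications; the corresponding probability measures are $\nu_f$ and $\widetilde\nu_{\widetilde f}$. Define $$m_f(\delta):=\nu_f(\{Q\in\mathcal{S}_d^{++}:M_d(Q)\le\delta\}),\qquad\widetilde m_{\widetilde f}(\delta):=\widetilde\nu_{\widetilde f}(\{\Sigma\in\Sigma_d^{++}:M_d(\Sigma)\le\delta\}).$$ $\mathcal{T}_d^{++}$ is the group of upper triangular $d\times d$ real matrices with strictly positive diagonal entries, written as pairs $(\boldsymbol\beta,\mathbf{u})\in(\mathbb{R}_{>0})^d\times\mathbb{R}^p$ ($\boldsymbol\beta$ the diagonal entries, $\mathbf{u}$ the strictly upper triangular ones). $\Theta_d^{++}$ is the subgroup of matrices of determinant $1$, written as pairs $(\boldsymbol\beta',\mathbf{u})\in(\mathbb{R}_{>0})^{d-1}\times\mathbb{R}^p$,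 where $\boldsymbol\beta'$ consists of the first $d-1$ diagonal entries. The Cholesky maps $\varphi_{chol}:\mathcal{T}_d^{++}\to\mathcal{S}_d^{++}$ and $\widetilde\varphi_{chol}:\Theta_d^{++}\to\Sigma_d^{++}$ are both given by $L\mapsto{}^tL\,L$. For $\boldsymbol\beta\in(\mathbb{R}_{>0})^d$ and $\beta_1>0$, $$G_f(\boldsymbol\beta):=2^d\prod_{i=1}^d\beta_i^{d-i+1}\int_{\mathbb{R}^p}(f\circ\varphi_{chol})(\boldsymbol\beta,\mathbf{u})\,\mathrm{d}\lambda_p(\mathbf{u}),\qquad g_f(\beta_1):=\int_{(\mathbb{R}_{>0})^{d-1}}G_f(\beta_1,\beta_2,\dots,\beta_d)\,\mathrm{d}\beta_2\cdots\mathrm{d}\beta_d.$$ For $\boldsymbol\beta'\in(\mathbb{R}_{>0})^{d-1}$ and $\beta_1'>0$, $$\widetilde G_{\widetilde f}(\boldsymbol\beta'):=2^{d-1}\prod_{i=1}^{d-1}(\beta_i')^{d-i+1}\int_{\mathbb{R}^p}(\widetilde f\circ\widetilde\varphi_{chol})(\boldsymbol\beta',\mathbf{u})\,\mathrm{d}\lambda_p(\mathbf{u}),\qquad\widetilde g_{\widetilde f}(\beta_1'):=\int_{(\mathbb{R}_{>0})^{d-2}}\widetilde G_{\widetilde f}(\beta_1',\dots,\beta_{d-1}')\,\mathrm{d}\beta_2'\cdots\mathrm{d}\beta_{d-1}'$$ (when $d=2$, $\widetilde g_{\widetilde f}=\widetilde G_{\widetilde f}$). *)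

theory Defs
  imports "HOL-Analysis.Analysis" "Jordan_Normal_Form.Determinant"
begin

(* Matrix rows and columns are numbered 0, ..., d-1, so an exponent d-i+1 at the
   1-based index i reads d-i at the 0-based index i. *)

definition spd :: "nat \<Rightarrow> real mat set" where
  "spd d = {Q \<in> carrier_mat d d. transpose_mat Q = Q \<and>
     (\<forall>v \<in> carrier_vec d. v \<noteq> 0\<^sub>v d \<longrightarrow> scalar_prod v (Q *\<^sub>v v) > 0)}"

definition spd1 :: "nat \<Rightarrow> real mat set" where
  "spd1 d = {Q \<in> spd d. Determinant.det Q = 1}"

definition min_form :: "nat \<Rightarrow> real mat \<Rightarrow> real" where
  "min_form d Q = (LEAST m. \<exists>a::int vec. a \<in> carrier_vec d \<and> a \<noteq> 0\<^sub>v d \<and>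
     m = scalar_prod (map_vec real_of_int a) (Q *\<^sub>v map_vec real_of_int a))"

definition upper_idx :: "nat \<Rightarrow> (nat \<times> nat) set" where
  "upper_idx d = {(i, j). i \<le> j \<and> j < d}"

definition upper_idx1 :: "nat \<Rightarrow> (nat \<times> nat) set" where
  "upper_idx1 d = upper_idx d - {(d - 1, d - 1)}"

definition strict_idx :: "nat \<Rightarrow> (nat \<times> nat) set" where
  "strict_idx d = {(i, j). i < j \<and> j < d}"

text \<open>Lebesgue measure on the coordinate space with finite index set \<open>I\<close>. If \<open>I\<close> is
  empty, this is the unit mass on the one-point space.\<close>

definition leb :: "'i set \<Rightarrow> ('i \<Rightarrow> real) measure" where
  "leb I = Pi\<^sub>M I (\<lambda>_. lborel)"

definition entries :: "(nat \<times> nat) set \<Rightarrow> real mat \<Rightarrow> (nat \<times> nat \<Rightarrow> real)" where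
  "entries I Q = restrict (\<lambda>ij. Q $$ ij) I"

text \<open>A set \<open>X\<close> of matrices that are determined by their entries in the positions \<open>I\<close> is
  identified with its image under \<open>entries I\<close>. The measurable subsets of \<open>X\<close> are the
  preimages of Borel sets, and the measure of a set is the Lebesgue measure of its image.\<close>

definition leb_mat :: "(nat \<times> nat) set \<Rightarrow> real mat set \<Rightarrow> real mat measure" where
  "leb_mat I X = distr (restrict_space (leb I) (entries I ` X))
     (vimage_algebra X (entries I) (leb I)) (the_inv_into X (entries I))"

definition leb_spd :: "nat \<Rightarrow> real mat measure" where
  "leb_spd d = leb_mat (upper_idx d) (spd d)"

definition leb_spd1 :: "nat \<Rightarrow> real mat measure" where
  "leb_spd1 d = leb_mat (upper_idx1 d) (spd1 d)"

definition prob_density :: "'a measure \<Rightarrow> ('a \<Rightarrow> real) \<Rightarrow> bool" where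
  "prob_density M f \<longleftrightarrow> f \<in> borel_measurable M \<and> (\<forall>x \<in> space M. 0 \<le> f x) \<and>
     (\<integral>\<^sup>+ x. ennreal (f x) \<partial>M) = 1"

definition m_f :: "nat \<Rightarrow> (real mat \<Rightarrow> real) \<Rightarrow> real \<Rightarrow> real" where
  "m_f d f \<delta> = measure (density (leb_spd d) (\<lambda>Q. ennreal (f Q))) {Q \<in> spd d. min_form d Q \<le> \<delta>}"

definition m1_f :: "nat \<Rightarrow> (real mat \<Rightarrow> real) \<Rightarrow> real \<Rightarrow> real" where
  "m1_f d f \<delta> = measure (density (leb_spd1 d) (\<lambda>Q. ennreal (f Q))) {Q \<in> spd1 d. min_form d Q \<le> \<delta>}"

definition tri_mat :: "nat \<Rightarrow> (nat \<Rightarrow> real) \<Rightarrow> (nat \<times> nat \<Rightarrow> real) \<Rightarrow> real mat" where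
  "tri_mat d \<beta> u = mat d d (\<lambda>(i, j). if i = j then \<beta> i else if i < j then u (i, j) else 0)"

text \<open>The last diagonal entry is the one that makes the determinant equal to 1.\<close>

definition tri_mat1 :: "nat \<Rightarrow> (nat \<Rightarrow> real) \<Rightarrow> (nat \<times> nat \<Rightarrow> real) \<Rightarrow> real mat" where
  "tri_mat1 d \<beta> u = tri_mat d (\<beta>(d - 1 := 1 / (\<Prod>i<d - 1. \<beta> i))) u"

definition chol :: "real mat \<Rightarrow> real mat" where
  "chol L = transpose_mat L * L"

text \<open>The functions below take values in \<open>[0, \<infinity>]\<close>: the integrals over fibres are finite only
  almost everywhere.\<close>

definition G_f :: "nat \<Rightarrow> (real mat \<Rightarrow> real) \<Rightarrow> (nat \<Rightarrow> real) \<Rightarrow> ennreal" where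
  "G_f d f \<beta> = ennreal (2 ^ d * (\<Prod>i<d. \<beta> i ^ (d - i))) *
     (\<integral>\<^sup>+ u. ennreal (f (chol (tri_mat d \<beta> u))) \<partial>leb (strict_idx d))"

definition g_f :: "nat \<Rightarrow> (real mat \<Rightarrow> real) \<Rightarrow> real \<Rightarrow> ennreal" where
  "g_f d f b = (\<integral>\<^sup>+ \<beta> \<in> (\<Pi>\<^sub>E i\<in>{1..<d}. {0<..}). G_f d f (\<beta>(0 := b)) \<partial>leb {1..<d})"

definition G1_f :: "nat \<Rightarrow> (real mat \<Rightarrow> real) \<Rightarrow> (nat \<Rightarrow> real) \<Rightarrow> ennreal" where
  "G1_f d f \<beta> = ennreal (2 ^ (d - 1) * (\<Prod>i<d - 1. \<beta> i ^ (d - i))) *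
     (\<integral>\<^sup>+ u. ennreal (f (chol (tri_mat1 d \<beta> u))) \<partial>leb (strict_idx d))"

definition g1_f :: "nat \<Rightarrow> (real mat \<Rightarrow> real) \<Rightarrow> real \<Rightarrow> ennreal" where
  "g1_f d f b = (\<integral>\<^sup>+ \<beta> \<in> (\<Pi>\<^sub>E i\<in>{1..<d - 1}. {0<..}). G1_f d f (\<beta>(0 := b)) \<partial>leb {1..<d - 1})"

definition I_cube :: "nat \<Rightarrow> real \<Rightarrow> (nat \<Rightarrow> real) set" where
  "I_cube d \<delta> = (\<Pi>\<^sub>E i\<in>{..<d}. {sqrt \<delta><..})"

definition \<Delta>_dom :: "nat \<Rightarrow> real \<Rightarrow> (nat \<Rightarrow> real) set" where
  "\<Delta>_dom k \<delta> = {\<beta> \<in> (\<Pi>\<^sub>E i\<in>{..<k}. {0<..}). (\<forall>i<k. \<beta> i > sqrt \<delta>) \<and> (\<Prod>i<k. \<beta> i) < 1 / sqrt \<delta>}"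

end

theory Submission
  imports Defs
begin

text \<open>Ordered by rows, the entries of \<open>chol L\<close> depend on the entries of \<open>L\<close> triangularly: the entry
  \<open>(i, j)\<close> is \<open>L\<^sub>i\<^sub>i L\<^sub>i\<^sub>j\<close> plus a polynomial in earlier entries. So the Cholesky change of variables, with its
  Jacobian, is obtained by adding one coordinate at a time, each time by a one-dimensional affine or
  quadratic substitution; dropping the very last entry gives the determinant 1 case. In these
  coordinates \<open>G_f\<close> is the density of the diagonal. The first unit vector shows that the minimum
  of the form is at most \<open>\<beta>\<^sub>0\<^sup>2\<close>, and the last nonzero coordinate \<open>a\<^sub>k\<close> of an integer vector shows that its
  value is at least \<open>\<beta>\<^sub>k\<^sup>2\<close>. Hence the event \<open>min_form \<le> \<delta>\<close> contains \<open>\<beta>\<^sub>0 \<le> \<surd>\<delta>\<close> and avoids the set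
  where every \<open>\<beta>\<^sub>i\<close> exceeds \<open>\<surd>\<delta>\<close>.\<close>

subsection \<open>Triangular changes of variables\<close>

text \<open>The dimension is a variable and fibre integrals may be infinite on a null set. Hence all
  integrals are nonnegative ones over products indexed by finite sets of positions, and the change
  of variables is assembled by Tonelli's theorem instead of a multivariate derivative. A measurable
  inverse has to travel with it: the measure on matrices is the pushforward of Lebesgue measure
  under the inverse of the coordinate map, so the set of coordinate vectors and that inverse must
  both be measurable. Both facts come from solving the triangular system entry by entry. That every
  positive definite matrix is reached is a separate, purely algebraic fact. The minimum of the form
  is a \<open>LEAST\<close> over the reals, which says something only when a least value exists;
  this is why the finiteness of the set of integer vectors with bounded form value has to be shown.
  The two halves of the theorem differ only in whether the last diagonal entry is a coordinate or
  the reciprocal of the product of the others.\<close>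

lemma product_sigma_finite_lborel: "product_sigma_finite (\<lambda>_::'i. lborel :: real measure)"
  by standard

lemma space_leb: "space (leb I) = extensional I"
  by (simp add: leb_def space_PiM PiE_UNIV_domain PiE_def)

lemma measurable_leb_component: "i \<in> I \<Longrightarrow> (\<lambda>x. x i) \<in> borel_measurable (leb I)"
  unfolding leb_def using measurable_component_singleton[of i I "\<lambda>_. lborel :: real measure"] by simp

lemma measurable_leb_restrict: "J \<subseteq> I \<Longrightarrow> (\<lambda>x. restrict x J) \<in> leb I \<rightarrow>\<^sub>M leb J"
  unfolding leb_def by (rule measurable_restrict_subset)

lemma measurable_into_leb:
  assumes "\<And>i. i \<in> I \<Longrightarrow> (\<lambda>x. f x i) \<in> borel_measurable N"
    and "\<And>x. x \<in> space N \<Longrightarrow> f x \<in> extensional I"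
  shows "f \<in> N \<rightarrow>\<^sub>M leb I"
  unfolding leb_def using assms
  by (intro measurable_PiM_single') (auto simp: PiE_def extensional_def)

lemma measurable_leb_fun_upd:
  assumes f: "f \<in> N \<rightarrow>\<^sub>M leb I" and g: "g \<in> borel_measurable N"
  shows "(\<lambda>x. (f x)(i := g x)) \<in> N \<rightarrow>\<^sub>M leb (insert i I)"
  unfolding leb_def
proof (rule measurable_fun_upd)
  show "insert i I = I \<union> {i}" by auto
  show "f \<in> N \<rightarrow>\<^sub>M Pi\<^sub>M I (\<lambda>_. lborel)" using f by (simp add: leb_def)
  show "g \<in> N \<rightarrow>\<^sub>M lborel" using g by simp
qed

lemma nn_integral_leb_insert:
  assumes "finite I" "i \<notin> I" "f \<in> borel_measurable (leb (insert i I))"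
  shows "(\<integral>\<^sup>+x. f x \<partial>leb (insert i I)) = (\<integral>\<^sup>+x. \<integral>\<^sup>+t. f (x(i := t)) \<partial>lborel \<partial>leb I)"
  using product_sigma_finite.product_nn_integral_insert[OF product_sigma_finite_lborel, of I i f] assms
  by (simp add: leb_def)

lemma sigma_finite_leb: "finite I \<Longrightarrow> sigma_finite_measure (leb I)"
  unfolding leb_def by (rule product_sigma_finite.sigma_finite[OF product_sigma_finite_lborel])

text \<open>The measurable left inverse \<open>S\<close> is what makes the image \<open>T ` D\<close> measurable.\<close>

definition subst_rule :: "'i set \<Rightarrow> ('i \<Rightarrow> real) set \<Rightarrow> (('i \<Rightarrow> real) \<Rightarrow> ('i \<Rightarrow> real)) \<Rightarrow>
    (('i \<Rightarrow> real) \<Rightarrow> ennreal) \<Rightarrow> bool" where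
  "subst_rule I D T J \<longleftrightarrow> D \<in> sets (leb I) \<and> T \<in> leb I \<rightarrow>\<^sub>M leb I \<and> J \<in> borel_measurable (leb I) \<and>
     (\<exists>S \<in> leb I \<rightarrow>\<^sub>M leb I. \<forall>x\<in>D. S (T x) = x) \<and>
     (\<forall>h \<in> borel_measurable (leb I).
        (\<integral>\<^sup>+x. h (T x) * J x * indicator D x \<partial>leb I) = (\<integral>\<^sup>+y. h y * indicator (T ` D) y \<partial>leb I))"

text \<open>Measurable maps need not send measurable sets to measurable sets. With a left inverse
  \<open>S\<close>, a point \<open>y\<close> is in the image exactly when \<open>S y\<close> lies in
  \<open>D\<close> and \<open>T (S y)\<close> agrees with \<open>y\<close> at finitely many
  coordinates, and these are measurable conditions.\<close>

lemma sets_image_of_left_inverse: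
  assumes "finite I" and D: "D \<in> sets (leb I)" and T: "T \<in> leb I \<rightarrow>\<^sub>M leb I"
    and S: "S \<in> leb I \<rightarrow>\<^sub>M leb I" and inv: "\<And>x. x \<in> D \<Longrightarrow> S (T x) = x"
  shows "T ` D \<in> sets (leb I)"
proof -
  have "T ` D = (S -` D \<inter> space (leb I)) \<inter> {y \<in> space (leb I). \<forall>i\<in>I. T (S y) i = y i}"
  proof (intro Set.set_eqI iffI)
    fix y assume "y \<in> T ` D"
    then obtain x where x: "x \<in> D" "y = T x" by auto
    with D have "x \<in> space (leb I)" using sets.sets_into_space by blast
    then have "y \<in> space (leb I)" unfolding x(2) by (rule measurable_space[OF T])
    then show "y \<in> (S -` D \<inter> space (leb I)) \<inter> {y \<in> space (leb I). \<forall>i\<in>I. T (S y) i = y i}"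
      using x(1) inv[OF x(1)] by (simp add: x(2))
  next
    fix y assume y: "y \<in> (S -` D \<inter> space (leb I)) \<inter> {y \<in> space (leb I). \<forall>i\<in>I. T (S y) i = y i}"
    then have "T (S y) \<in> space (leb I)" using measurable_space[OF measurable_compose[OF S T]] by blast
    then have "T (S y) = y" using y by (intro extensionalityI[of _ I]) (auto simp: space_leb)
    then show "y \<in> T ` D" using y by (auto intro!: image_eqI[of _ _ "S y"])
  qed
  moreover have "S -` D \<inter> space (leb I) \<in> sets (leb I)" using S D by measurable
  moreover have "{y \<in> space (leb I). \<forall>i\<in>I. T (S y) i = y i} \<in> sets (leb I)"
  proof (rule sets.sets_Collect_finite_All)
    fix i assume i: "i \<in> I"
    have [measurable]: "(\<lambda>y. T (S y) i) \<in> borel_measurable (leb I)"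
      using measurable_compose[OF measurable_compose[OF S T] measurable_leb_component[OF i]] by simp
    have [measurable]: "(\<lambda>y. y i) \<in> borel_measurable (leb I)" using measurable_leb_component[OF i] .
    show "{y \<in> space (leb I). T (S y) i = y i} \<in> sets (leb I)" by measurable
  qed fact
  ultimately show ?thesis by simp
qed

lemma subst_rule_image_sets: "finite I \<Longrightarrow> subst_rule I D T J \<Longrightarrow> T ` D \<in> sets (leb I)"
  unfolding subst_rule_def
  by (elim conjE bexE) (rule sets_image_of_left_inverse[where I=I and D=D], assumption+, simp)

lemma subst_rule_cong:
  assumes "subst_rule I D T J" and "D' = D"
    and T: "\<And>x. x \<in> space (leb I) \<Longrightarrow> T' x = T x" and J: "\<And>x. x \<in> space (leb I) \<Longrightarrow> J' x = J x"
  shows "subst_rule I D' T' J'"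
proof -
  have D: "D \<in> sets (leb I)" using assms(1) by (simp add: subst_rule_def)
  then have sub: "x \<in> space (leb I)" if "x \<in> D" for x using that sets.sets_into_space by blast
  have "T' ` D = T ` D" using T sub by (auto simp: image_iff)
  moreover have "T' \<in> leb I \<rightarrow>\<^sub>M leb I \<longleftrightarrow> T \<in> leb I \<rightarrow>\<^sub>M leb I" by (rule measurable_cong) (rule T)
  moreover have "J' \<in> borel_measurable (leb I) \<longleftrightarrow> J \<in> borel_measurable (leb I)" by (rule measurable_cong) (rule J)
  moreover have "(\<integral>\<^sup>+x. h (T' x) * J' x * indicator D x \<partial>leb I) = (\<integral>\<^sup>+x. h (T x) * J x * indicator D x \<partial>leb I)" for h
    by (rule nn_integral_cong) (simp add: T J)
  ultimately show ?thesis using assms(1,2) T sub unfolding subst_rule_def by simp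
qed

lemma subst_rule_empty: "subst_rule {} (space (leb {})) (\<lambda>x. x) (\<lambda>_. 1)"
  unfolding subst_rule_def
  by (intro conjI bexI[of _ "\<lambda>x. x"] ballI) simp_all

text \<open>Tonelli's theorem with the new coordinate innermost: for fixed old coordinates
  \<open>x\<close>, \<open>line\<close> substitutes in the new one, and the rule for
  \<open>I\<close> then substitutes in \<open>x\<close>. Since \<open>T\<close> ignores the new
  coordinate, the densities multiply, as on the diagonal of a triangular Jacobian matrix.\<close>

lemma subst_rule_insert:
  fixes \<phi> \<psi> :: "('i \<Rightarrow> real) \<Rightarrow> real \<Rightarrow> real" and w :: "('i \<Rightarrow> real) \<Rightarrow> real \<Rightarrow> ennreal"
  assumes R: "subst_rule I D T J" and fin: "finite I" and e: "e \<notin> I"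
    and \<phi>[measurable]: "(\<lambda>(x, t). \<phi> x t) \<in> borel_measurable (leb I \<Otimes>\<^sub>M borel)"
    and \<psi>[measurable]: "(\<lambda>(x, t). \<psi> x t) \<in> borel_measurable (leb I \<Otimes>\<^sub>M borel)"
    and w[measurable]: "(\<lambda>(x, t). w x t) \<in> borel_measurable (leb I \<Otimes>\<^sub>M borel)"
    and K[measurable]: "K \<in> sets borel"
    and inv: "\<And>x t. x \<in> D \<Longrightarrow> t \<in> K \<Longrightarrow> \<psi> x (\<phi> x t) = t"
    and line: "\<And>x h. x \<in> D \<Longrightarrow> h \<in> borel_measurable borel \<Longrightarrow>
      (\<integral>\<^sup>+t. h (\<phi> x t) * w x t * indicator K t \<partial>lborel) = (\<integral>\<^sup>+s. h s * indicator (\<phi> x ` K) s \<partial>lborel)"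
  shows "subst_rule (insert e I) {x \<in> space (leb (insert e I)). restrict x I \<in> D \<and> x e \<in> K}
     (\<lambda>x. (T (restrict x I))(e := \<phi> (restrict x I) (x e)))
     (\<lambda>x. J (restrict x I) * w (restrict x I) (x e))"
    (is "subst_rule ?I ?D ?T ?J")
proof -
  from R obtain S where D[measurable]: "D \<in> sets (leb I)" and T[measurable]: "T \<in> leb I \<rightarrow>\<^sub>M leb I"
    and J[measurable]: "J \<in> borel_measurable (leb I)" and S[measurable]: "S \<in> leb I \<rightarrow>\<^sub>M leb I"
    and ST: "\<And>x. x \<in> D \<Longrightarrow> S (T x) = x"
    and sub: "\<And>h. h \<in> borel_measurable (leb I) \<Longrightarrow>
        (\<integral>\<^sup>+x. h (T x) * J x * indicator D x \<partial>leb I) = (\<integral>\<^sup>+y. h y * indicator (T ` D) y \<partial>leb I)"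
    unfolding subst_rule_def by blast
  have Dsub: "x \<in> space (leb I)" if "x \<in> D" for x using that D sets.sets_into_space by blast
  have res[measurable]: "(\<lambda>x. restrict x I) \<in> leb ?I \<rightarrow>\<^sub>M leb I" by (rule measurable_leb_restrict) auto
  have ev[measurable]: "(\<lambda>x. x e) \<in> borel_measurable (leb ?I)" by (rule measurable_leb_component) simp
  have mp[measurable]: "(\<lambda>x. (restrict x I, x e)) \<in> leb ?I \<rightarrow>\<^sub>M leb I \<Otimes>\<^sub>M borel" by measurable
  have mphi[measurable]: "(\<lambda>x. \<phi> (restrict x I) (x e)) \<in> borel_measurable (leb ?I)"
    using measurable_compose[OF mp \<phi>] by simp
  have mw[measurable]: "(\<lambda>x. w (restrict x I) (x e)) \<in> borel_measurable (leb ?I)"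
    using measurable_compose[OF mp w] by simp
  have mD: "?D \<in> sets (leb ?I)" by measurable
  have mT: "?T \<in> leb ?I \<rightarrow>\<^sub>M leb ?I"
    by (rule measurable_leb_fun_upd) measurable
  have mJ: "?J \<in> borel_measurable (leb ?I)" by measurable
  \<comment> \<open>Back substitution: \<open>S\<close> recovers the old coordinates from the old
    part of \<open>y\<close>, and only then can the new equation be solved by
    \<open>\<psi>\<close>.\<close>
  define S' where "S' = (\<lambda>y. (S (restrict y I))(e := \<psi> (S (restrict y I)) (y e)))"
  have mpsi: "(\<lambda>y. \<psi> (S (restrict y I)) (y e)) \<in> borel_measurable (leb ?I)"
    using measurable_compose[of "\<lambda>y. (S (restrict y I), y e)" "leb ?I" "leb I \<Otimes>\<^sub>M borel", OF _ \<psi>] by simp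
  have mS': "S' \<in> leb ?I \<rightarrow>\<^sub>M leb ?I" unfolding S'_def
    by (rule measurable_leb_fun_upd[OF _ mpsi]) measurable
  have Tres: "restrict ((T x)(e := s)) I = T x" if "x \<in> D" for x s
  proof -
    have "T x \<in> extensional I" using measurable_space[OF T Dsub[OF that]] by (simp add: space_leb)
    then show ?thesis using e by (auto simp: extensional_def restrict_def fun_eq_iff)
  qed
  have upd: "restrict (x(e := t)) I = x" "x(e := t) \<in> space (leb ?I)" if "x \<in> space (leb I)" for x t
    using that e by (auto simp: space_leb extensional_def restrict_def fun_eq_iff)
  have S'T: "S' (?T x) = x" if "x \<in> ?D" for x
  proof -
    have "(restrict x I)(e := x e) = x" using that by (auto simp: space_leb extensional_def restrict_def fun_eq_iff)
    then show ?thesis using that ST inv Tres unfolding S'_def by simp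
  qed
  \<comment> \<open>Injectivity of \<open>T\<close> on \<open>D\<close> pins down the old
    coordinates, so the part of the image above \<open>T x\<close> is a single slice, the image of
    \<open>K\<close> under \<open>\<phi> x\<close>.\<close>
  have img: "(T x)(e := s) \<in> ?T ` ?D \<longleftrightarrow> s \<in> \<phi> x ` K" if x: "x \<in> D" for x s
  proof
    assume "(T x)(e := s) \<in> ?T ` ?D"
    then obtain x' where x': "x' \<in> ?D" "(T x)(e := s) = ?T x'" by auto
    then have "T x = T (restrict x' I)" using Tres[OF x] Tres[of "restrict x' I"] by (metis (mono_tags, lifting) mem_Collect_eq)
    then have "x = restrict x' I" using ST x x'(1) by (metis (mono_tags, lifting) mem_Collect_eq)
    moreover have "s = \<phi> (restrict x' I) (x' e)" using x'(2) by (metis fun_upd_same)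
    ultimately show "s \<in> \<phi> x ` K" using x'(1) by auto
  next
    assume "s \<in> \<phi> x ` K"
    then obtain t where "t \<in> K" "s = \<phi> x t" by auto
    then show "(T x)(e := s) \<in> ?T ` ?D" using upd[OF Dsub[OF x], of t] x
      by (intro image_eqI[of _ _ "x(e := t)"]) auto
  qed
  define E where "E = ?T ` ?D"
  have E[measurable]: "E \<in> sets (leb ?I)" unfolding E_def
    by (rule sets_image_of_left_inverse[OF _ mD mT mS' S'T]) (use fin in auto)
  have ET: "restrict y I \<in> T ` D" if "y \<in> E" for y
    using that Tres unfolding E_def by auto
  have "(\<integral>\<^sup>+x. h (?T x) * ?J x * indicator ?D x \<partial>leb ?I) = (\<integral>\<^sup>+y. h y * indicator E y \<partial>leb ?I)"
    if h[measurable]: "h \<in> borel_measurable (leb ?I)" for h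
  proof -
    \<comment> \<open>\<open>H\<close> integrates along the slices of the image and depends on the
      old target coordinates alone, so the rule for \<open>I\<close> applies to it.\<close>
    define H where "H = (\<lambda>y. \<integral>\<^sup>+s. h (y(e := s)) * indicator E (y(e := s)) \<partial>lborel)"
    have mupd[measurable]: "(\<lambda>(y, s). y(e := s)) \<in> leb I \<Otimes>\<^sub>M borel \<rightarrow>\<^sub>M leb ?I"
      unfolding case_prod_beta by (rule measurable_leb_fun_upd) measurable
    have mH: "H \<in> borel_measurable (leb I)" unfolding H_def
    proof (rule sigma_finite_measure.borel_measurable_nn_integral)
      show "sigma_finite_measure (lborel :: real measure)" by standard
      have "(\<lambda>p. h ((\<lambda>(y, s). y(e := s)) p) * indicator E ((\<lambda>(y, s). y(e := s)) p)) \<in> borel_measurable (leb I \<Otimes>\<^sub>M borel)"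
        by measurable
      then show "(\<lambda>(y, s). h (y(e := s)) * indicator E (y(e := s))) \<in> borel_measurable (leb I \<Otimes>\<^sub>M lborel)"
        by (simp add: case_prod_beta cong: measurable_cong_sets)
    qed
    have "(\<lambda>x. h (?T x) * ?J x * indicator ?D x) \<in> borel_measurable (leb ?I)"
      using measurable_compose[OF mT h] mJ mD by measurable
    then have "(\<integral>\<^sup>+x. h (?T x) * ?J x * indicator ?D x \<partial>leb ?I) =
       (\<integral>\<^sup>+x. \<integral>\<^sup>+t. h (?T (x(e := t))) * ?J (x(e := t)) * indicator ?D (x(e := t)) \<partial>lborel \<partial>leb I)"
      by (rule nn_integral_leb_insert[OF fin e])
    also have "\<dots> = (\<integral>\<^sup>+x. H (T x) * J x * indicator D x \<partial>leb I)"
    proof (rule nn_integral_cong)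
      fix x assume x: "x \<in> space (leb I)"
      show "(\<integral>\<^sup>+t. h (?T (x(e := t))) * ?J (x(e := t)) * indicator ?D (x(e := t)) \<partial>lborel) = H (T x) * J x * indicator D x"
      proof (cases "x \<in> D")
        case False
        then show ?thesis using upd[OF x] by (simp add: indicator_def)
      next
        case True
        have Tx: "T x \<in> space (leb I)" by (rule measurable_space[OF T x])
        have mh: "(\<lambda>s. h ((T x)(e := s))) \<in> borel_measurable borel"
        proof -
          have "(\<lambda>s. (T x)(e := s)) \<in> borel \<rightarrow>\<^sub>M leb ?I"
            using Tx by (intro measurable_leb_fun_upd) auto
          from measurable_compose[OF this h] show ?thesis .
        qed
        have mwx: "(\<lambda>t. w x t) \<in> borel_measurable borel" "(\<lambda>t. \<phi> x t) \<in> borel_measurable borel"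
          using measurable_compose[OF measurable_Pair1'[OF x] w] measurable_compose[OF measurable_Pair1'[OF x] \<phi>] by auto
        have mc: "(\<lambda>t. h ((T x)(e := \<phi> x t)) * w x t * indicator K t) \<in> borel_measurable lborel"
          using measurable_compose[OF mwx(2) mh] mwx(1) K
          by (simp add: borel_measurable_times_ennreal)
        have "(\<integral>\<^sup>+t. h (?T (x(e := t))) * ?J (x(e := t)) * indicator ?D (x(e := t)) \<partial>lborel)
          = (\<integral>\<^sup>+t. J x * (h ((T x)(e := \<phi> x t)) * w x t * indicator K t) \<partial>lborel)"
          using True upd[OF x] by (intro nn_integral_cong) (auto simp: indicator_def mult_ac)
        also have "\<dots> = J x * (\<integral>\<^sup>+t. h ((T x)(e := \<phi> x t)) * w x t * indicator K t \<partial>lborel)"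
          by (rule nn_integral_cmult[OF mc])
        also have "\<dots> = J x * (\<integral>\<^sup>+s. h ((T x)(e := s)) * indicator (\<phi> x ` K) s \<partial>lborel)"
          using line[OF True mh] by simp
        also have "(\<integral>\<^sup>+s. h ((T x)(e := s)) * indicator (\<phi> x ` K) s \<partial>lborel) = H (T x)"
          unfolding H_def E_def using img[OF True] by (intro nn_integral_cong) (simp add: indicator_def)
        also have "J x * H (T x) = H (T x) * J x * indicator D x" using True by (simp add: mult.commute)
        finally show ?thesis .
      qed
    qed
    also have "\<dots> = (\<integral>\<^sup>+y. H y * indicator (T ` D) y \<partial>leb I)" by (rule sub[OF mH])
    also have "\<dots> = (\<integral>\<^sup>+y. H y \<partial>leb I)"
    proof (rule nn_integral_cong)
      fix y assume y: "y \<in> space (leb I)"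
      have "H y = 0" if "y \<notin> T ` D"
      proof -
        have "y(e := s) \<notin> E" for s using ET[of "y(e := s)"] upd(1)[OF y] that by auto
        then show ?thesis unfolding H_def by simp
      qed
      then show "H y * indicator (T ` D) y = H y" by (auto simp: indicator_def)
    qed
    also have "\<dots> = (\<integral>\<^sup>+y. h y * indicator E y \<partial>leb ?I)"
      unfolding H_def by (rule nn_integral_leb_insert[OF fin e, symmetric]) measurable
    finally show ?thesis .
  qed
  then show ?thesis unfolding subst_rule_def E_def
    by (intro conjI bexI[OF _ mS'] ballI mD mT mJ) (rule S'T)
qed

section \<open>One-dimensional substitutions, affine and quadratic\<close>

lemma nn_integral_subst_of_emeasure:
  fixes \<phi> :: "real \<Rightarrow> real" and w :: "real \<Rightarrow> ennreal"
  assumes [measurable]: "\<phi> \<in> borel_measurable borel" "w \<in> borel_measurable borel" "K \<in> sets borel" "L \<in> sets borel"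
    "h \<in> borel_measurable borel"
    and eq: "\<And>A. A \<in> sets borel \<Longrightarrow>
      (\<integral>\<^sup>+t. indicator A (\<phi> t) * w t * indicator K t \<partial>lborel) = (\<integral>\<^sup>+s. indicator A s * indicator L s \<partial>lborel)"
  shows "(\<integral>\<^sup>+t. h (\<phi> t) * w t * indicator K t \<partial>lborel) = (\<integral>\<^sup>+s. h s * indicator L s \<partial>lborel)"
proof -
  \<comment> \<open>Both sides integrate \<open>h\<close> against a measure: the pushforward under
    \<open>\<phi>\<close> of the weighted Lebesgue measure on \<open>K\<close>, and Lebesgue measure
    on \<open>L\<close>. Agreement on Borel sets, which is \<open>eq\<close>, makes the two measures
    equal.\<close>
  have "distr (density lborel (\<lambda>t. w t * indicator K t)) borel \<phi> = density lborel (indicator L)"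
  proof (rule measure_eqI)
    fix A assume "A \<in> sets (distr (density lborel (\<lambda>t. w t * indicator K t)) borel \<phi>)"
    then have A[measurable]: "A \<in> sets borel" by simp
    have "emeasure (distr (density lborel (\<lambda>t. w t * indicator K t)) borel \<phi>) A
      = (\<integral>\<^sup>+t. w t * indicator K t * indicator (\<phi> -` A) t \<partial>lborel)"
      using measurable_sets_borel[OF assms(1) A] by (subst emeasure_distr) (auto simp: emeasure_density)
    also have "\<dots> = (\<integral>\<^sup>+s. indicator A s * indicator L s \<partial>lborel)"
      using eq[OF A] by (auto simp: indicator_def mult_ac intro!: arg_cong2[of _ _ _ _ nn_integral] cong: if_cong)
    also have "\<dots> = emeasure (density lborel (indicator L)) A"
      by (subst emeasure_density) (auto simp: mult_ac)
    finally show "emeasure (distr (density lborel (\<lambda>t. w t * indicator K t)) borel \<phi>) A = emeasure (density lborel (indicator L)) A" .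
  qed simp
  then have "nn_integral (distr (density lborel (\<lambda>t. w t * indicator K t)) borel \<phi>) h = nn_integral (density lborel (indicator L)) h"
    by simp
  then show ?thesis by (simp add: nn_integral_distr nn_integral_density mult_ac)
qed

lemma nn_integral_affine_subst:
  fixes a c :: real
  assumes [measurable]: "h \<in> borel_measurable borel" and a: "a > 0"
  shows "(\<integral>\<^sup>+t. h (a * t + c) * ennreal a \<partial>lborel) = (\<integral>\<^sup>+s. h s \<partial>lborel)"
proof -
  have "(\<integral>\<^sup>+t. h (a * t + c) * ennreal a \<partial>lborel) = (\<integral>\<^sup>+t. h (c + a * t) \<partial>lborel) * ennreal a"
    by (subst nn_integral_multc) (auto simp: add.commute)
  then show ?thesis
    using nn_integral_real_affine[of h a c] a by (simp add: mult.commute)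
qed

text \<open>The map t^2 + c increases from the positive half line onto the half line above c, with
  derivative 2t. The classical rule concerns compact intervals and real integrands, so the claim is
  reduced to indicators of Borel sets on [0, n], and monotone convergence passes to the half
  line.\<close>

lemma nn_integral_square_subst:
  fixes c :: real
  assumes h: "h \<in> borel_measurable borel"
  shows "(\<integral>\<^sup>+t. h (t\<^sup>2 + c) * ennreal (2 * t) * indicator {0<..} t \<partial>lborel) = (\<integral>\<^sup>+s. h s * indicator {c<..} s \<partial>lborel)"
proof (rule nn_integral_subst_of_emeasure[OF _ _ _ _ h])
  fix A :: "real set" assume A[measurable]: "A \<in> sets borel"
  define F where "F = (\<lambda>t::real. indicator A (t\<^sup>2 + c) * ennreal (2 * t) :: ennreal)"
  have F[measurable]: "F \<in> borel_measurable borel" unfolding F_def by measurable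
  have fin: "(\<integral>\<^sup>+s. indicator A s * indicator {c..(real n)\<^sup>2 + c} s \<partial>lborel) = (\<integral>\<^sup>+t. F t * indicator {0..real n} t \<partial>lborel)" for n
  proof -
    have "(\<integral>\<^sup>+s. ennreal (indicat_real A s) * indicator {0\<^sup>2 + c..(real n)\<^sup>2 + c} s \<partial>lborel)
      = (\<integral>\<^sup>+t. ennreal (indicat_real A (t\<^sup>2 + c)) * ennreal (2 * t) * indicator {0..real n} t \<partial>lborel)"
      (is "?l = ?r")
    proof -
      have "?l = (\<integral>\<^sup>+t. ennreal (indicat_real A (t\<^sup>2 + c) * (2 * t) * indicator {0..real n} t) \<partial>lborel)"
        unfolding nn_integral_set_ennreal
      proof (rule nn_integral_substitution)
        fix t :: real
        show "((\<lambda>t. t\<^sup>2 + c) has_real_derivative 2 * t) (at t)"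
          by (auto intro!: derivative_eq_intros)
      qed (auto intro!: continuous_intros simp: set_borel_measurable_def)
      also have "\<dots> = ?r"
        by (intro nn_integral_cong) (auto simp: indicator_def ennreal_mult)
      finally show ?thesis .
    qed
    then show ?thesis by (simp add: F_def ennreal_indicator)
  qed
  have U1: "(\<Union>n. {0..real n}) = {0..}" by (auto simp: real_arch_simple)
  have U2: "(\<Union>n. {c..(real n)\<^sup>2 + c}) = {c..}"
  proof (intro Set.set_eqI iffI)
    fix s assume "s \<in> {c..}"
    obtain n :: nat where n: "s - c \<le> real n" using real_arch_simple by blast
    have "real n \<le> (real n)\<^sup>2" by (metis le_square of_nat_le_iff of_nat_mult power2_eq_square)
    then have "s \<le> (real n)\<^sup>2 + c" using n by linarith
    then show "s \<in> (\<Union>n. {c..(real n)\<^sup>2 + c})" using \<open>s \<in> {c..}\<close> by (intro UN_I[of n]) auto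
  qed auto
  \<comment> \<open>The open half lines of the claim and the closed ones of the exhaustion differ by
    one point, a null set.\<close>
  have ae: "(\<integral>\<^sup>+t. g t * indicator {b<..} t \<partial>lborel) = (\<integral>\<^sup>+t. g t * indicator {b..} t \<partial>lborel)" for g :: "real \<Rightarrow> ennreal" and b
    using AE_lborel_singleton[of b] by (intro nn_integral_cong_AE) (auto elim!: eventually_mono simp: indicator_def)
  have L1: "(\<integral>\<^sup>+t. F t * indicator {0..} t \<partial>lborel) = (SUP n. \<integral>\<^sup>+t. F t * indicator {0..real n} t \<partial>lborel)"
    using SUP_emeasure_incseq[of "\<lambda>n. {0..real n}" "density lborel F"]
    by (simp add: incseq_def image_subset_iff U1 emeasure_density)
  have L2: "(\<integral>\<^sup>+s. indicator A s * indicator {c..} s \<partial>lborel) = (SUP n. \<integral>\<^sup>+s. indicator A s * indicator {c..(real n)\<^sup>2 + c} s \<partial>lborel)"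
    using SUP_emeasure_incseq[of "\<lambda>n. {c..(real n)\<^sup>2 + c}" "density lborel (indicator A)"]
    by (simp add: incseq_def image_subset_iff U2 emeasure_density power_mono)
  have "(\<integral>\<^sup>+t. F t * indicator {0..} t \<partial>lborel) = (\<integral>\<^sup>+s. indicator A s * indicator {c..} s \<partial>lborel)"
    using L1 L2 fin by simp
  then show "(\<integral>\<^sup>+t. indicator A (t\<^sup>2 + c) * ennreal (2 * t) * indicator {0<..} t \<partial>lborel) = (\<integral>\<^sup>+s. indicator A s * indicator {c<..} s \<partial>lborel)"
    unfolding ae F_def .
qed measurable

subsection \<open>The Cholesky map in coordinates\<close>

text \<open>Initial segments in row-major order; the whole triangle is \<open>n = d * d\<close>, and \<open>n = d * d - 1\<close>
  omits the bottom right position.\<close>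

definition key_idx :: "nat \<Rightarrow> nat \<Rightarrow> (nat \<times> nat) set" where
  "key_idx d n = {(i, j). i \<le> j \<and> j < d \<and> i * d + j < n}"

text \<open>The sum stops at k = i because the factor is upper triangular. If (i, j) belongs to an
  initial segment \<open>I\<close>, then so do all positions read here.\<close>

definition chol_entries :: "(nat \<times> nat) set \<Rightarrow> (nat \<times> nat \<Rightarrow> real) \<Rightarrow> (nat \<times> nat \<Rightarrow> real)" where
  "chol_entries I x = restrict (\<lambda>(i, j). \<Sum>k\<le>i. x (k, i) * x (k, j)) I"

definition pos_diag :: "(nat \<times> nat) set \<Rightarrow> (nat \<times> nat \<Rightarrow> real) set" where
  "pos_diag I = {x \<in> space (leb I). \<forall>i. (i, i) \<in> I \<longrightarrow> 0 < x (i, i)}"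

text \<open>The diagonal of the triangular Jacobian matrix: the derivative of the entry (i, j) of
  \<open>chol_entries\<close> in the variable (i, j) itself. On the diagonal this variable occurs
  squared, whence the 2.\<close>

definition chol_jac :: "(nat \<times> nat) set \<Rightarrow> (nat \<times> nat \<Rightarrow> real) \<Rightarrow> ennreal" where
  "chol_jac I x = (\<Prod>(i, j)\<in>I. ennreal (if i = j then 2 * x (i, i) else x (i, i)))"

lemma finite_key_idx: "finite (key_idx d n)"
  by (rule finite_subset[of _ "{..<d} \<times> {..<d}"]) (auto simp: key_idx_def)

text \<open>For k \<le> i \<le> j both positions have a row no later than i and a column at most j,
  so their keys do not exceed that of (i, j). This is the triangularity of the system.\<close>

lemma key_idx_closed:
  assumes "(i, j) \<in> key_idx d n" "k \<le> i"
  shows "(k, i) \<in> key_idx d n" "(k, j) \<in> key_idx d n"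
proof -
  have ij: "i \<le> j" "j < d" "i * d + j < n" using assms(1) by (auto simp: key_idx_def)
  have "k * d \<le> i * d" using assms(2) by simp
  then have "k * d + i < n" "k * d + j < n" using ij by linarith+
  then show "(k, i) \<in> key_idx d n" "(k, j) \<in> key_idx d n" using ij assms(2) unfolding key_idx_def by auto
qed

lemma pos_diag_insert:
  assumes "e \<notin> I" "e = (i, j)"
  shows "pos_diag (insert e I) = {x \<in> space (leb (insert e I)). restrict x I \<in> pos_diag I \<and> x e \<in> (if i = j then {0<..} else UNIV)}"
  using assms by (auto simp: pos_diag_def space_leb)

text \<open>A key belongs to at most one position of the triangle, so each induction step adds one
  coordinate or none. The slope \<open>x (i, i)\<close> of an off-diagonal equation is already
  available, because the diagonal position opens its row, and it is positive on
  \<open>pos_diag\<close>.\<close>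

lemma subst_rule_chol: "subst_rule (key_idx d n) (pos_diag (key_idx d n)) (chol_entries (key_idx d n)) (chol_jac (key_idx d n))"
proof (induction n)
  case 0
  have "key_idx d 0 = {}" by (auto simp: key_idx_def)
  then show ?case
    by (auto intro!: subst_rule_cong[OF subst_rule_empty]
        simp: pos_diag_def chol_entries_def chol_jac_def space_leb extensional_def)
next
  case (Suc n)
  define I where "I = key_idx d n"
  have fin: "finite I" unfolding I_def by (rule finite_key_idx)
  show ?case
  proof (cases "\<exists>i j. i \<le> j \<and> j < d \<and> i * d + j = n")
    case False
    then have "key_idx d (Suc n) = key_idx d n" by (fastforce simp: key_idx_def less_Suc_eq)
    then show ?thesis using Suc by simp
  next
    case True
    then obtain i j where ij: "i \<le> j" "j < d" "i * d + j = n" by auto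
    define e where "e = (i, j)"
    have eI: "e \<notin> I" using ij by (auto simp: e_def I_def key_idx_def)
    \<comment> \<open>Division with remainder by \<open>d\<close> recovers a position from its key,
      as columns are below \<open>d\<close>.\<close>
    have uniq: "i' = i \<and> j' = j" if "i' \<le> j'" "j' < d" "i' * d + j' = n" for i' j'
    proof -
      have "n div d = i'" "n mod d = j'" using that(2) unfolding that(3)[symmetric] by auto
      moreover have "n div d = i" "n mod d = j" using ij(2) unfolding ij(3)[symmetric] by auto
      ultimately show ?thesis by simp
    qed
    have Suc_eq: "key_idx d (Suc n) = insert e I"
      using ij uniq by (fastforce simp: e_def I_def key_idx_def less_Suc_eq)
    have mem: "(k, i) \<in> I" "(k, j) \<in> I" if "k < i" for k
    proof -
      have "Suc k * d \<le> i * d" using that by (intro mult_right_mono) auto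
      then show "(k, i) \<in> I" "(k, j) \<in> I" using that ij unfolding I_def key_idx_def by auto
    qed
    have memd: "(i, i) \<in> I" if "i < j" using that ij unfolding I_def key_idx_def by auto
    \<comment> \<open>The contribution of the rows above i to the new entry. It reads old
      coordinates only, so for the new variable it is a translation constant.\<close>
    define c where "c = (\<lambda>x. \<Sum>k<i. x (k, i) * x (k, j) :: real)"
    have mc[measurable]: "c \<in> borel_measurable (leb I)" unfolding c_def
      by (intro borel_measurable_sum borel_measurable_times measurable_leb_component mem) auto
    define \<phi> where "\<phi> = (\<lambda>x t. (if i = j then t\<^sup>2 else x (i, i) * t) + c x)"
    \<comment> \<open>The root inverts the square because \<open>K\<close> is the positive half line
      at a diagonal position.\<close>
    define \<psi> where "\<psi> = (\<lambda>x s. if i = j then sqrt (s - c x) else (s - c x) / x (i, i))"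
    define w where "w = (\<lambda>x t. ennreal (if i = j then 2 * t else x (i, i)))"
    define K where "K = (if i = j then {0<..} else UNIV :: real set)"
    have xc[measurable]: "(\<lambda>x. x (i, i)) \<in> borel_measurable (leb I)" if "i \<noteq> j"
      using that ij by (intro measurable_leb_component memd) auto
    have meas: "(\<lambda>(x, t). \<phi> x t) \<in> borel_measurable (leb I \<Otimes>\<^sub>M borel)"
      "(\<lambda>(x, t). \<psi> x t) \<in> borel_measurable (leb I \<Otimes>\<^sub>M borel)"
      "(\<lambda>(x, t). w x t) \<in> borel_measurable (leb I \<Otimes>\<^sub>M borel)"
      by (cases "i = j"; simp add: \<phi>_def \<psi>_def w_def)+
    have pos: "0 < x (i, i)" if "x \<in> pos_diag I" "i \<noteq> j" for x
      using that ij memd by (auto simp: pos_diag_def)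
    have "subst_rule (insert e I) {x \<in> space (leb (insert e I)). restrict x I \<in> pos_diag I \<and> x e \<in> K}
     (\<lambda>x. (chol_entries I (restrict x I))(e := \<phi> (restrict x I) (x e)))
     (\<lambda>x. chol_jac I (restrict x I) * w (restrict x I) (x e))"
    proof (rule subst_rule_insert[OF Suc[folded I_def] fin eI meas])
      show "K \<in> sets borel" by (simp add: K_def)
      show "\<psi> x (\<phi> x t) = t" if "x \<in> pos_diag I" "t \<in> K" for x t
        using that pos[of x] by (auto simp: \<psi>_def \<phi>_def K_def)
      show "(\<integral>\<^sup>+t. h (\<phi> x t) * w x t * indicator K t \<partial>lborel) = (\<integral>\<^sup>+s. h s * indicator (\<phi> x ` K) s \<partial>lborel)"
        if x: "x \<in> pos_diag I" and h: "h \<in> borel_measurable borel" for x h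
      proof (cases "i = j")
        case True
        have "\<phi> x ` K = {c x<..}"
        proof (intro Set.set_eqI iffI)
          fix s assume "s \<in> {c x<..}"
          then show "s \<in> \<phi> x ` K" using True by (intro image_eqI[of _ _ "sqrt (s - c x)"]) (auto simp: \<phi>_def K_def)
        qed (auto simp: True \<phi>_def K_def)
        then show ?thesis using nn_integral_square_subst[OF h, of "c x"] True by (simp add: \<phi>_def w_def K_def)
      next
        case False
        have "\<phi> x ` K = UNIV"
        proof (intro Set.set_eqI iffI)
          fix s :: real
          show "s \<in> \<phi> x ` K" using False pos[OF x False] by (intro image_eqI[of _ _ "(s - c x) / x (i, i)"]) (auto simp: \<phi>_def K_def)
        qed auto
        then show ?thesis using nn_integral_affine_subst[OF h pos[OF x False], of "c x"] False by (simp add: \<phi>_def w_def K_def)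
      qed
    qed
    then show ?thesis unfolding Suc_eq
    proof (rule subst_rule_cong)
      show "pos_diag (insert e I) = {x \<in> space (leb (insert e I)). restrict x I \<in> pos_diag I \<and> x e \<in> K}"
        using pos_diag_insert[OF eI e_def] by (simp add: K_def)
      fix x assume "x \<in> space (leb (insert e I))"
      have c_eq: "c (restrict x I) = (\<Sum>k<i. x (k, i) * x (k, j))"
        unfolding c_def using mem by (intro sum.cong) auto
      have "\<phi> (restrict x I) (x e) = (\<Sum>k\<le>i. x (k, i) * x (k, j))"
        using memd ij unfolding \<phi>_def c_eq lessThan_Suc_atMost[symmetric]
        by (cases "i = j") (auto simp: e_def power2_eq_square)
      moreover have "(\<Sum>k\<le>i'. restrict x I (k, i') * restrict x I (k, j')) = (\<Sum>k\<le>i'. x (k, i') * x (k, j'))"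
        if "(i', j') \<in> I" for i' j'
        using key_idx_closed[OF that[unfolded I_def]] by (intro sum.cong) (auto simp: I_def)
      ultimately show "chol_entries (insert e I) x = (chol_entries I (restrict x I))(e := \<phi> (restrict x I) (x e))"
        by (auto simp: chol_entries_def fun_eq_iff e_def)
      have "w (restrict x I) (x e) = ennreal (if i = j then 2 * x (i, i) else x (i, i))"
        using memd ij by (auto simp: w_def e_def)
      moreover have "chol_jac I (restrict x I) = chol_jac I x" unfolding chol_jac_def
        using key_idx_closed(1)[of _ _ d n] by (intro prod.cong) (auto simp: I_def[symmetric])
      ultimately show "chol_jac (insert e I) x = chol_jac I (restrict x I) * w (restrict x I) (x e)"
        using fin eI by (simp add: chol_jac_def e_def mult.commute)
    qed
  qed
qed

section \<open>The two triangles as initial segments, and their Jacobians\<close>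

lemma upper_idx_eq_key_idx: "upper_idx d = key_idx d (d * d)"
proof -
  have "i * d + j < d * d" if "i \<le> j" "j < d" for i j
  proof -
    have "i * d + j < Suc i * d" using that by simp
    also have "\<dots> \<le> d * d" using that by (intro mult_right_mono) auto
    finally show ?thesis .
  qed
  then show ?thesis by (auto simp: upper_idx_def key_idx_def)
qed

text \<open>The bottom right position has key \<open>d * d - 1\<close>, the largest key in the
  triangle, so stopping one key short removes exactly this position.\<close>

lemma upper_idx1_eq_key_idx: "upper_idx1 d = key_idx d (d * d - 1)"
proof -
  have "i * d + j < d * d - 1 \<longleftrightarrow> (i, j) \<noteq> (d - 1, d - 1)" if "i \<le> j" "j < d" for i j
  proof (cases "i = d - 1")
    case True
    then have "j = d - 1" using that by auto
    moreover have "(d - 1) * d + (d - 1) = d * d - 1" using that by (cases d) auto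
    ultimately show ?thesis using True by simp
  next
    case False
    then have "Suc (Suc i) * d \<le> d * d" using that by (intro mult_right_mono) auto
    then have "i * d + j < d * d - 1" using that by (auto simp: algebra_simps)
    then show ?thesis using False by simp
  qed
  then show ?thesis by (auto simp: upper_idx1_def upper_idx_def key_idx_def)
qed

lemma upper_idx_Sigma: "upper_idx d = (SIGMA i:{..<d}. {i..<d})"
  "upper_idx1 d = (SIGMA i:{..<d - 1}. {i..<d})"
  by (auto simp: upper_idx1_def upper_idx_def)

text \<open>Row i of the triangle has d - i positions, each contributing the factor
  \<open>x (i, i)\<close>, and its diagonal position contributes an extra 2. This produces the
  weights in front of the fibre integrals, for \<open>k = d\<close> and for
  \<open>k = d - 1\<close>.\<close>

lemma chol_jac_Sigma:
  assumes "k \<le> d" and pos: "\<And>i. i < k \<Longrightarrow> 0 < x (i, i)"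
  shows "chol_jac (SIGMA i:{..<k}. {i..<d}) x = ennreal (2 ^ k * (\<Prod>i<k. x (i, i) ^ (d - i)))"
proof -
  have "chol_jac (SIGMA i:{..<k}. {i..<d}) x
      = (\<Prod>i<k. \<Prod>j\<in>{i..<d}. ennreal (if i = j then 2 * x (i, i) else x (i, i)))"
    unfolding chol_jac_def by (rule prod.Sigma[symmetric]) auto
  also have "\<dots> = (\<Prod>i<k. ennreal (2 * x (i, i) ^ (d - i)))"
  proof (rule prod.cong)
    fix i assume "i \<in> {..<k}"
    then have i: "i < d" "0 < x (i, i)" using assms by auto
    have "(\<Prod>j\<in>{i..<d}. ennreal (if i = j then 2 * x (i, i) else x (i, i)))
      = ennreal (2 * x (i, i)) * (\<Prod>j\<in>{Suc i..<d}. ennreal (x (i, i)))"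
      using i by (simp add: prod.atLeast_Suc_lessThan)
    also have "\<dots> = ennreal (2 * x (i, i) * x (i, i) ^ (d - Suc i))"
      using i by (simp add: ennreal_mult ennreal_power)
    also have "2 * x (i, i) * x (i, i) ^ (d - Suc i) = 2 * x (i, i) ^ (d - i)"
      using i by (simp add: Suc_diff_Suc[symmetric])
    finally show "(\<Prod>j\<in>{i..<d}. ennreal (if i = j then 2 * x (i, i) else x (i, i))) = ennreal (2 * x (i, i) ^ (d - i))" .
  qed simp
  also have "\<dots> = ennreal (\<Prod>i<k. 2 * x (i, i) ^ (d - i))"
    using pos by (intro prod_ennreal) (simp add: less_imp_le)
  finally show ?thesis by (simp add: prod.distrib)
qed

subsection \<open>Integration over a parametrized set of matrices\<close>

context
  fixes I :: "(nat \<times> nat) set" and D T J and X :: "real mat set" and \<Phi>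
  assumes R: "subst_rule I D T J" and fin: "finite I"
    and img: "\<Phi> ` D = X" and ent: "\<And>x. x \<in> D \<Longrightarrow> entries I (\<Phi> x) = T x"
begin

lemma param_mem: "x \<in> D \<Longrightarrow> \<Phi> x \<in> X"
  using img by auto

lemma param_domain_sets: "D \<in> sets (leb I)"
  using R by (simp add: subst_rule_def)

lemma param_entries_image: "entries I ` X = T ` D"
  using ent unfolding img[symmetric] by (auto simp: image_iff)

lemma param_inj: "inj_on T D"
proof -
  obtain S where "\<forall>x\<in>D. S (T x) = x" using R unfolding subst_rule_def by blast
  then show ?thesis by (intro inj_on_inverseI[of D S]) simp
qed

text \<open>Injectivity of \<open>entries I\<close> on \<open>X\<close> is inherited from that of
  \<open>T\<close> on \<open>D\<close>. So \<open>the_inv_into\<close> is a genuine inverse, and in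
  terms of parameters it is \<open>\<Phi>\<close>.\<close>

lemma param_the_inv: "x \<in> D \<Longrightarrow> the_inv_into X (entries I) (T x) = \<Phi> x"
proof -
  have "inj_on (entries I) X"
    unfolding img[symmetric] using param_inj ent by (auto simp: inj_on_def)
  then show "x \<in> D \<Longrightarrow> the_inv_into X (entries I) (T x) = \<Phi> x"
    using the_inv_into_f_f param_mem ent by metis
qed

lemma param_measurable: "\<Phi> \<in> restrict_space (leb I) D \<rightarrow>\<^sub>M leb_mat I X"
proof -
  have "\<Phi> \<in> restrict_space (leb I) D \<rightarrow>\<^sub>M vimage_algebra X (entries I) (leb I)"
  proof (rule measurable_vimage_algebra2)
    show "\<Phi> \<in> space (restrict_space (leb I) D) \<rightarrow> X" using param_mem by (auto simp: space_restrict_space)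
    have "T \<in> restrict_space (leb I) D \<rightarrow>\<^sub>M leb I"
      using R by (intro measurable_restrict_space1) (simp add: subst_rule_def)
    then show "(\<lambda>x. entries I (\<Phi> x)) \<in> restrict_space (leb I) D \<rightarrow>\<^sub>M leb I"
      by (rule subst[OF measurable_cong, rotated]) (simp add: ent space_restrict_space)
  qed
  then show ?thesis by (simp add: leb_mat_def cong: measurable_cong_sets)
qed

lemma param_compose_measurable:
  fixes f :: "real mat \<Rightarrow> ennreal"
  assumes "f \<in> borel_measurable (leb_mat I X)"
  shows "(\<lambda>x. f (\<Phi> x) * indicator D x) \<in> borel_measurable (leb I)"
  using measurable_compose[OF param_measurable assms] param_domain_sets
  by (subst borel_measurable_restrict_space_iff_ennreal[symmetric]) auto

lemma param_the_inv_measurable: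
  "the_inv_into X (entries I) \<in> restrict_space (leb I) (T ` D) \<rightarrow>\<^sub>M vimage_algebra X (entries I) (leb I)"
proof (rule measurable_vimage_algebra2)
  show "the_inv_into X (entries I) \<in> space (restrict_space (leb I) (T ` D)) \<rightarrow> X"
    using param_the_inv param_mem by (auto simp: space_restrict_space)
  have "(\<lambda>y. y) \<in> restrict_space (leb I) (T ` D) \<rightarrow>\<^sub>M leb I" by (intro measurable_restrict_space1) simp
  then show "(\<lambda>y. entries I (the_inv_into X (entries I) y)) \<in> restrict_space (leb I) (T ` D) \<rightarrow>\<^sub>M leb I"
    by (rule subst[OF measurable_cong, rotated]) (auto simp: space_restrict_space param_the_inv ent)
qed

text \<open>By definition the left side is an integral over coordinate vectors, that is, over the
  image of \<open>D\<close> under \<open>T\<close>. The substitution rule pulls it back to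
  \<open>D\<close>, where the inverse coordinate map after \<open>T\<close> is
  \<open>\<Phi>\<close>.\<close>

lemma nn_integral_leb_mat:
  fixes f :: "real mat \<Rightarrow> ennreal"
  assumes f: "f \<in> borel_measurable (leb_mat I X)"
  shows "(\<integral>\<^sup>+Q. f Q \<partial>leb_mat I X) = (\<integral>\<^sup>+x. f (\<Phi> x) * J x * indicator D x \<partial>leb I)"
proof -
  let ?inv = "the_inv_into X (entries I)"
  have E: "T ` D \<in> sets (leb I)" by (rule subst_rule_image_sets[OF fin R])
  then have E': "T ` D \<inter> space (leb I) \<in> sets (leb I)" by blast
  have fv: "f \<in> borel_measurable (vimage_algebra X (entries I) (leb I))"
    using f by (simp add: leb_mat_def cong: measurable_cong_sets)
  have "(\<lambda>y. f (?inv y)) \<in> borel_measurable (restrict_space (leb I) (T ` D))"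
    by (rule measurable_compose[OF param_the_inv_measurable fv])
  then have h: "(\<lambda>y. f (?inv y) * indicator (T ` D) y) \<in> borel_measurable (leb I)"
    using borel_measurable_restrict_space_iff_ennreal[OF E', of "\<lambda>y. f (?inv y)"] by simp
  have "(\<integral>\<^sup>+Q. f Q \<partial>leb_mat I X) = (\<integral>\<^sup>+y. f (?inv y) \<partial>restrict_space (leb I) (T ` D))"
    unfolding leb_mat_def param_entries_image
    by (rule nn_integral_distr[OF param_the_inv_measurable]) (use fv in simp)
  also have "\<dots> = (\<integral>\<^sup>+y. f (?inv y) * indicator (T ` D) y \<partial>leb I)"
    by (rule nn_integral_restrict_space[OF E'])
  \<comment> \<open>The function \<open>f (?inv y)\<close> is known to be measurable only on the
    image of \<open>D\<close>. The indicator is doubled: one copy makes the function measurable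
    everywhere, the other is the one in the substitution rule.\<close>
  also have "\<dots> = (\<integral>\<^sup>+y. (f (?inv y) * indicator (T ` D) y) * indicator (T ` D) y \<partial>leb I)"
    by (intro nn_integral_cong) (simp add: indicator_def)
  also have "\<dots> = (\<integral>\<^sup>+x. (f (?inv (T x)) * indicator (T ` D) (T x)) * J x * indicator D x \<partial>leb I)"
  proof -
    have "\<forall>h\<in>borel_measurable (leb I). (\<integral>\<^sup>+x. h (T x) * J x * indicator D x \<partial>leb I) = (\<integral>\<^sup>+y. h y * indicator (T ` D) y \<partial>leb I)"
      using R unfolding subst_rule_def by blast
    from bspec[OF this h] show ?thesis by (rule sym)
  qed
  also have "\<dots> = (\<integral>\<^sup>+x. f (\<Phi> x) * J x * indicator D x \<partial>leb I)"
    by (intro nn_integral_cong) (auto simp: indicator_def param_the_inv)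
  finally show ?thesis .
qed

text \<open>Measurable subsets of \<open>X\<close> are preimages under \<open>entries I\<close>. The
  preimage of the parameter set under the left inverse \<open>S\<close> is a measurable set of
  coordinate vectors, and it cuts out \<open>A\<close>.\<close>

lemma sets_leb_matI:
  assumes "A \<subseteq> X" and A': "{x \<in> D. \<Phi> x \<in> A} \<in> sets (leb I)"
  shows "A \<in> sets (leb_mat I X)"
proof -
  obtain S where S: "S \<in> leb I \<rightarrow>\<^sub>M leb I" "\<And>x. x \<in> D \<Longrightarrow> S (T x) = x"
    using R unfolding subst_rule_def by blast
  let ?B = "S -` {x \<in> D. \<Phi> x \<in> A} \<inter> space (leb I)"
  have TD: "T x \<in> space (leb I)" if "x \<in> D" for x
  proof (rule measurable_space[of T "leb I"])
    show "T \<in> leb I \<rightarrow>\<^sub>M leb I" using R by (simp add: subst_rule_def)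
    show "x \<in> space (leb I)" using that param_domain_sets sets.sets_into_space by blast
  qed
  have "A = entries I -` ?B \<inter> X"
  proof (intro Set.set_eqI iffI)
    fix Q assume "Q \<in> A"
    then obtain x where x: "x \<in> D" "Q = \<Phi> x" using assms(1) img by blast
    then show "Q \<in> entries I -` ?B \<inter> X" using \<open>Q \<in> A\<close> S(2)[OF x(1)] ent TD param_mem by simp
  next
    fix Q assume Q: "Q \<in> entries I -` ?B \<inter> X"
    then obtain x where x: "x \<in> D" "Q = \<Phi> x" using img by blast
    then show "Q \<in> A" using Q S(2)[OF x(1)] ent by simp
  qed
  moreover have "entries I -` ?B \<inter> X \<in> sets (vimage_algebra X (entries I) (leb I))"
    by (rule in_vimage_algebra[OF measurable_sets[OF S(1) A']])
  ultimately have "A \<in> sets (vimage_algebra X (entries I) (leb I))"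
    by simp
  then show ?thesis by (simp add: leb_mat_def)
qed

end

subsection \<open>Quadratic forms and the Cholesky decomposition\<close>

text \<open>The squared Euclidean length of L a for the upper triangular matrix L with diagonal
  \<open>b\<close> and strict upper part \<open>u\<close>.\<close>

definition tri_form :: "nat \<Rightarrow> (nat \<Rightarrow> real) \<Rightarrow> (nat \<times> nat \<Rightarrow> real) \<Rightarrow> (nat \<Rightarrow> real) \<Rightarrow> real" where
  "tri_form d b u a = (\<Sum>i<d. (b i * a i + (\<Sum>j\<in>{i<..<d}. u (i, j) * a j))\<^sup>2)"

lemma tri_mat_carrier [simp]: "tri_mat d b u \<in> carrier_mat d d"
  by (simp add: tri_mat_def)

lemma chol_carrier [simp]: "L \<in> carrier_mat d d \<Longrightarrow> chol L \<in> carrier_mat d d"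
  by (simp add: chol_def)

lemma chol_symmetric: "L \<in> carrier_mat d d \<Longrightarrow> transpose_mat (chol L) = chol L"
  by (simp add: chol_def transpose_mult[of _ d d _ d])

lemma tri_mat_cong:
  assumes "\<And>i. i < d \<Longrightarrow> b i = b' i" "\<And>i j. i < j \<Longrightarrow> j < d \<Longrightarrow> u (i, j) = u' (i, j)"
  shows "tri_mat d b u = tri_mat d b' u'"
  using assms by (intro eq_matI) (auto simp: tri_mat_def)

lemma tri_mat_mult_vec:
  assumes v: "v \<in> carrier_vec d" and i: "i < d"
  shows "(tri_mat d b u *\<^sub>v v) $ i = b i * v $ i + (\<Sum>j\<in>{i<..<d}. u (i, j) * v $ j)"
proof -
  have "(tri_mat d b u *\<^sub>v v) $ i = (\<Sum>j<d. (if i = j then b i else if i < j then u (i, j) else 0) * v $ j)"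
    using v i by (simp add: tri_mat_def scalar_prod_def atLeast0LessThan)
  also have "\<dots> = (\<Sum>j\<in>insert i {i<..<d}. (if i = j then b i else if i < j then u (i, j) else 0) * v $ j)"
    using i by (intro sum.mono_neutral_right) auto
  also have "\<dots> = b i * v $ i + (\<Sum>j\<in>{i<..<d}. u (i, j) * v $ j)"
    by (subst sum.insert) (auto intro!: sum.cong)
  finally show ?thesis .
qed

lemma chol_tri_mat_form:
  assumes v: "v \<in> carrier_vec d"
  shows "scalar_prod v (chol (tri_mat d b u) *\<^sub>v v) = tri_form d b u (\<lambda>i. v $ i)"
proof -
  let ?L = "tri_mat d b u"
  have Lv: "?L *\<^sub>v v \<in> carrier_vec d" by (rule mult_mat_vec_carrier[OF tri_mat_carrier v])
  have "chol ?L *\<^sub>v v = transpose_mat ?L *\<^sub>v (?L *\<^sub>v v)"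
    unfolding chol_def using v by (intro assoc_mult_mat_vec[of _ d d _ d]) auto
  then have "scalar_prod v (chol ?L *\<^sub>v v) = scalar_prod (transpose_mat ?L *\<^sub>v (?L *\<^sub>v v)) v"
    using v mult_mat_vec_carrier[OF _ Lv, of "transpose_mat ?L" d]
    by (simp add: comm_scalar_prod[of _ d])
  also have "\<dots> = scalar_prod (?L *\<^sub>v v) (?L *\<^sub>v v)"
    using v Lv by (intro transpose_vec_mult_scalar[of _ d d]) auto
  also have "\<dots> = (\<Sum>i<d. (?L *\<^sub>v v) $ i * (?L *\<^sub>v v) $ i)"
    by (simp add: scalar_prod_def atLeast0LessThan tri_mat_def)
  also have "\<dots> = tri_form d b u (\<lambda>i. v $ i)"
    using v by (simp add: tri_form_def power2_eq_square tri_mat_mult_vec)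
  finally show ?thesis .
qed

lemma chol_tri_mat_index:
  assumes "i \<le> j" "j < d"
  shows "chol (tri_mat d b u) $$ (i, j) =
    (\<Sum>k\<le>i. (if k = i then b i else u (k, i)) * (if k = j then b j else u (k, j)))"
proof -
  have "chol (tri_mat d b u) $$ (i, j) = (\<Sum>k<d. tri_mat d b u $$ (k, i) * tri_mat d b u $$ (k, j))"
    using assms by (simp add: chol_def times_mat_def scalar_prod_def atLeast0LessThan tri_mat_def)
  also have "\<dots> = (\<Sum>k\<le>i. tri_mat d b u $$ (k, i) * tri_mat d b u $$ (k, j))"
    using assms by (intro sum.mono_neutral_right) (auto simp: tri_mat_def)
  also have "\<dots> = (\<Sum>k\<le>i. (if k = i then b i else u (k, i)) * (if k = j then b j else u (k, j)))"
    using assms by (intro sum.cong) (auto simp: tri_mat_def)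
  finally show ?thesis .
qed

text \<open>Component k of L a reduces to \<open>b k * a k\<close> once all later coordinates
  vanish, and the other squares only add.\<close>

lemma tri_form_lower:
  assumes "k < d" "\<And>j. k < j \<Longrightarrow> j < d \<Longrightarrow> a j = 0"
  shows "(b k * a k)\<^sup>2 \<le> tri_form d b u a"
proof -
  have "(\<Sum>j\<in>{k<..<d}. u (k, j) * a j) = 0" using assms by (intro sum.neutral) auto
  then have "(b k * a k)\<^sup>2 = (b k * a k + (\<Sum>j\<in>{k<..<d}. u (k, j) * a j))\<^sup>2" by simp
  also have "\<dots> \<le> tri_form d b u a" unfolding tri_form_def
    using assms(1) by (intro member_le_sum[of k "{..<d}" "\<lambda>i. (b i * a i + (\<Sum>j\<in>{i<..<d}. u (i, j) * a j))\<^sup>2"]) auto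
  finally show ?thesis .
qed

lemma last_nonzero_index:
  fixes v :: "'a :: zero vec"
  assumes "v \<in> carrier_vec d" "v \<noteq> 0\<^sub>v d"
  obtains k where "k < d" "v $ k \<noteq> 0" "\<And>j. k < j \<Longrightarrow> j < d \<Longrightarrow> v $ j = 0"
proof -
  let ?N = "{k. k < d \<and> v $ k \<noteq> 0}"
  have ne: "?N \<noteq> {}"
  proof
    assume "?N = {}"
    then have "v = 0\<^sub>v d" using assms(1) by (intro eq_vecI) auto
    then show False using assms(2) by simp
  qed
  have fin: "finite ?N" by simp
  show thesis
  proof (rule that[of "Max ?N"])
    show "Max ?N < d" "v $ Max ?N \<noteq> 0" using Max_in[OF fin ne] by auto
    show "v $ j = 0" if "Max ?N < j" "j < d" for j
    proof (rule ccontr)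
      assume "v $ j \<noteq> 0"
      then have "j \<le> Max ?N" using that by (intro Max_ge[OF fin]) auto
      then show False using that by simp
    qed
  qed
qed

lemma tri_form_pos:
  assumes v: "v \<in> carrier_vec d" "v \<noteq> 0\<^sub>v d" and b: "\<And>i. i < d \<Longrightarrow> 0 < b i"
  shows "0 < tri_form d b u (\<lambda>i. v $ i)"
proof -
  obtain k where k: "k < d" "v $ k \<noteq> 0" "\<And>j. k < j \<Longrightarrow> j < d \<Longrightarrow> v $ j = 0"
    using last_nonzero_index[OF v] by metis
  have "0 < (b k * v $ k)\<^sup>2" using k b[of k] by simp
  also have "\<dots> \<le> tri_form d b u (\<lambda>i. v $ i)" using k by (intro tri_form_lower) auto
  finally show ?thesis .
qed

lemma chol_tri_mat_spd:
  assumes "\<And>i. i < d \<Longrightarrow> 0 < b i"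
  shows "chol (tri_mat d b u) \<in> spd d"
  unfolding spd_def using tri_form_pos[OF _ _ assms] by (auto simp: chol_symmetric[of _ d] chol_tri_mat_form)

lemma det_chol_tri_mat: "Determinant.det (chol (tri_mat d b u)) = (\<Prod>i<d. b i)\<^sup>2"
proof -
  have "Determinant.det (tri_mat d b u) = (\<Prod>i<d. b i)"
    by (subst det_upper_triangular[of _ d])
      (auto simp: tri_mat_def prod_list_diag_prod atLeast0LessThan)
  then show ?thesis unfolding chol_def
    by (subst det_mult[of _ d]) (auto simp: det_transpose[of _ d] power2_eq_square)
qed

text \<open>Completing the square in the first variable leaves the Schur complement, which is again
  positive definite.\<close>

lemma cholesky_exists_aux:
  fixes Q :: "nat \<Rightarrow> nat \<Rightarrow> real"
  assumes "\<And>i j. Q i j = Q j i"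
    and "\<And>v. \<exists>i\<in>{m..<m + n}. v i \<noteq> 0 \<Longrightarrow> 0 < (\<Sum>i\<in>{m..<m + n}. \<Sum>j\<in>{m..<m + n}. v i * Q i j * v j)"
  shows "\<exists>l. (\<forall>i\<in>{m..<m + n}. 0 < l i i) \<and>
    (\<forall>i j. m \<le> i \<longrightarrow> i \<le> j \<longrightarrow> j < m + n \<longrightarrow> Q i j = (\<Sum>k\<in>{m..i}. l k i * l k j))"
  using assms
\<comment> \<open>The window of indices starts at \<open>m\<close> so that the Schur complement,
  which lives on the indices from \<open>Suc m\<close> on, needs no renumbering.\<close>
proof (induction n arbitrary: m Q)
  case 0
  show ?case by auto
next
  case (Suc n)
  define R where "R = {Suc m..<Suc m + n}"
  have split: "(\<Sum>i\<in>{m..<m + Suc n}. g i) = g m + (\<Sum>i\<in>R. g i)" for g :: "nat \<Rightarrow> real"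
    unfolding R_def by (subst sum.atLeast_Suc_lessThan) auto
  have form: "(\<Sum>i\<in>{m..<m + Suc n}. \<Sum>j\<in>{m..<m + Suc n}. v i * Q i j * v j)
     = Q m m * (v m)\<^sup>2 + 2 * v m * (\<Sum>j\<in>R. Q m j * v j) + (\<Sum>i\<in>R. \<Sum>j\<in>R. v i * Q i j * v j)" for v
  proof -
    have "(\<Sum>i\<in>R. v i * Q i m * v m) = v m * (\<Sum>j\<in>R. Q m j * v j)"
      using Suc.prems(1)[of _ m] by (simp add: sum_distrib_left mult_ac)
    moreover have "(\<Sum>j\<in>R. v m * Q m j * v j) = v m * (\<Sum>j\<in>R. Q m j * v j)"
      by (simp add: sum_distrib_left mult_ac)
    ultimately show ?thesis
      unfolding split sum.distrib by (simp add: power2_eq_square algebra_simps)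
  qed
  have mR: "j \<noteq> m" if "j \<in> R" for j using that by (simp add: R_def)
  have q: "0 < Q m m"
  proof -
    have "0 < (\<Sum>i\<in>{m..<m + Suc n}. \<Sum>j\<in>{m..<m + Suc n}. (if i = m then 1 else 0) * Q i j * (if j = m then 1 else 0))"
      by (rule Suc.prems(2)) auto
    then show ?thesis unfolding form by (simp add: mR cong: sum.cong_simp)
  qed
  define Q' where "Q' = (\<lambda>i j. Q i j - Q m i * Q m j / Q m m)"
  have "\<exists>l. (\<forall>i\<in>{Suc m..<Suc m + n}. 0 < l i i) \<and>
    (\<forall>i j. Suc m \<le> i \<longrightarrow> i \<le> j \<longrightarrow> j < Suc m + n \<longrightarrow> Q' i j = (\<Sum>k\<in>{Suc m..i}. l k i * l k j))"
  proof (rule Suc.IH)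
    show "Q' i j = Q' j i" for i j unfolding Q'_def using Suc.prems(1)[of i j] by (simp add: mult.commute)
    fix v assume "\<exists>i\<in>{Suc m..<Suc m + n}. v i \<noteq> (0::real)"
    then have v: "\<exists>i\<in>R. v i \<noteq> 0" by (simp add: R_def)
    define s where "s = (\<Sum>j\<in>R. Q m j * v j)"
    \<comment> \<open>Position m receives the value that minimizes the form when the other
      coordinates are fixed; the form then equals that of \<open>Q'\<close> at
      \<open>v\<close>.\<close>
    define v' where "v' = v(m := - s / Q m m)"
    have "0 < (\<Sum>i\<in>{m..<m + Suc n}. \<Sum>j\<in>{m..<m + Suc n}. v' i * Q i j * v' j)"
      
    proof (rule Suc.prems(2))
      obtain i where "i \<in> R" "v i \<noteq> 0" using v by blast
      then show "\<exists>i\<in>{m..<m + Suc n}. v' i \<noteq> 0"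
        using mR by (intro bexI[of _ i]) (auto simp: v'_def R_def)
    qed
    also have "\<dots> = Q m m * (s / Q m m)\<^sup>2 - 2 * (s / Q m m) * s + (\<Sum>i\<in>R. \<Sum>j\<in>R. v i * Q i j * v j)"
      unfolding form s_def[symmetric]
      by (simp add: v'_def mR s_def cong: sum.cong_simp)
    also have "\<dots> = (\<Sum>i\<in>R. \<Sum>j\<in>R. v i * Q i j * v j) - s * s / Q m m"
      using q by (simp add: power2_eq_square field_simps)
    also have "s * s / Q m m = (\<Sum>i\<in>R. \<Sum>j\<in>R. v i * (Q m i * Q m j / Q m m) * v j)"
      unfolding s_def sum_product sum_divide_distrib by (intro sum.cong) (auto simp: field_simps)
    also have "(\<Sum>i\<in>R. \<Sum>j\<in>R. v i * Q i j * v j) - \<dots> = (\<Sum>i\<in>R. \<Sum>j\<in>R. v i * Q' i j * v j)"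
      unfolding Q'_def sum_subtractf[symmetric] by (simp add: algebra_simps)
    finally show "0 < (\<Sum>i\<in>{Suc m..<Suc m + n}. \<Sum>j\<in>{Suc m..<Suc m + n}. v i * Q' i j * v j)" unfolding R_def .
  qed
  then obtain l' where l': "\<And>i. i \<in> {Suc m..<Suc m + n} \<Longrightarrow> 0 < l' i i"
    "\<And>i j. Suc m \<le> i \<Longrightarrow> i \<le> j \<Longrightarrow> j < Suc m + n \<Longrightarrow> Q' i j = (\<Sum>k\<in>{Suc m..i}. l' k i * l' k j)"
    by metis
  \<comment> \<open>Row m of the factor is forced by row m of \<open>Q\<close>; what its products
    leave of the later entries is \<open>Q'\<close>.\<close>
  define l where "l = l'(m := \<lambda>j. Q m j / sqrt (Q m m))"
  have sq: "sqrt (Q m m) * sqrt (Q m m) = Q m m" using q by simp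
  have lm: "l m i * l m j = Q m i * Q m j / Q m m" for i j
    using sq by (simp add: l_def)
  show ?case
  proof (intro exI[of _ l] conjI ballI allI impI)
    fix i assume "i \<in> {m..<m + Suc n}"
    then show "0 < l i i" using q l'(1)[of i] by (cases "i = m") (auto simp: l_def)
  next
    fix i j assume ij: "m \<le> i" "i \<le> j" "j < m + Suc n"
    show "Q i j = (\<Sum>k\<in>{m..i}. l k i * l k j)"
    proof (cases "i = m")
      case True
      then show ?thesis using q by (simp add: lm)
    next
      case False
      have "(\<Sum>k\<in>{m..i}. l k i * l k j) = l m i * l m j + (\<Sum>k\<in>{Suc m..i}. l k i * l k j)"
        using ij by (subst sum.atLeast_Suc_atMost) auto
      also have "(\<Sum>k\<in>{Suc m..i}. l k i * l k j) = (\<Sum>k\<in>{Suc m..i}. l' k i * l' k j)"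
        by (intro sum.cong) (auto simp: l_def)
      also have "\<dots> = Q' i j" using l'(2)[of i j] ij False by simp
      finally show ?thesis by (simp add: lm Q'_def)
    qed
  qed
qed

lemma cholesky_exists:
  assumes "Q \<in> spd d"
  obtains b u where "\<And>i. i < d \<Longrightarrow> 0 < b i" "Q = chol (tri_mat d b u)"
proof -
  have Q: "Q \<in> carrier_mat d d" "transpose_mat Q = Q"
    and pd: "\<And>v. v \<in> carrier_vec d \<Longrightarrow> v \<noteq> 0\<^sub>v d \<Longrightarrow> 0 < scalar_prod v (Q *\<^sub>v v)"
    using assms by (auto simp: spd_def)
  \<comment> \<open>Extended by zero, so that symmetry holds for all pairs of naturals and not only
    for indices below \<open>d\<close>.\<close>
  define q where "q = (\<lambda>i j. if i < d \<and> j < d then Q $$ (i, j) else 0)"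
  have "\<exists>l. (\<forall>i\<in>{0..<0 + d}. 0 < l i i) \<and>
    (\<forall>i j. 0 \<le> i \<longrightarrow> i \<le> j \<longrightarrow> j < 0 + d \<longrightarrow> q i j = (\<Sum>k\<in>{0..i}. l k i * l k j))"
  proof (rule cholesky_exists_aux)
    show sym: "q i j = q j i" for i j
    proof (cases "i < d \<and> j < d")
      case True
      then have "Q $$ (i, j) = transpose_mat Q $$ (j, i)" using Q(1) by simp
      then show ?thesis unfolding Q(2) using True by (simp add: q_def)
    qed (auto simp: q_def)
    fix v assume v: "\<exists>i\<in>{0..<0 + d}. v i \<noteq> (0::real)"
    have "Matrix.vec d v \<noteq> 0\<^sub>v d"
    proof
      assume "Matrix.vec d v = 0\<^sub>v d"
      then have "Matrix.vec d v $ i = 0\<^sub>v d $ i" for i by simp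
      then show False using v by (metis add_0 atLeastLessThan_iff index_vec index_zero_vec(1))
    qed
    then have "0 < scalar_prod (Matrix.vec d v) (Q *\<^sub>v Matrix.vec d v)" by (intro pd) auto
    also have "\<dots> = (\<Sum>i\<in>{0..<d}. \<Sum>j\<in>{0..<d}. v i * q i j * v j)"
      using Q(1) by (auto simp: scalar_prod_def q_def sum_distrib_left mult_ac intro!: sum.cong)
    finally show "0 < (\<Sum>i\<in>{0..<0 + d}. \<Sum>j\<in>{0..<0 + d}. v i * q i j * v j)" by simp
  qed
  then obtain l where l': "\<forall>i\<in>{0..<0 + d}. 0 < l i i"
    "\<forall>i j. 0 \<le> i \<longrightarrow> i \<le> j \<longrightarrow> j < 0 + d \<longrightarrow> q i j = (\<Sum>k\<in>{0..i}. l k i * l k j)"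
    by (elim exE conjE) (rule that)
  have l: "0 < l i i" if "i < d" for i using l'(1) that by simp
  have lq: "q i j = (\<Sum>k\<in>{0..i}. l k i * l k j)" if "i \<le> j" "j < d" for i j using l'(2) that by simp
  let ?C = "chol (tri_mat d (\<lambda>i. l i i) (\<lambda>(i, j). l i j))"
  have C: "?C \<in> carrier_mat d d" "transpose_mat ?C = ?C" using chol_symmetric[OF tri_mat_carrier] by auto
  have le: "Q $$ (i, j) = ?C $$ (i, j)" if "i \<le> j" "j < d" for i j
  proof -
    have "Q $$ (i, j) = q i j" using that by (simp add: q_def)
    also have "\<dots> = ?C $$ (i, j)" unfolding lq[OF that] chol_tri_mat_index[OF that]
      by (intro sum.cong) auto
    finally show ?thesis .
  qed
  have "Q = ?C"
  proof (rule eq_matI)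
    fix i j assume "i < dim_row ?C" "j < dim_col ?C"
    then have ij: "i < d" "j < d" using C(1) by auto
    show "Q $$ (i, j) = ?C $$ (i, j)"
    proof (cases "i \<le> j")
      case False
      have "Q $$ (i, j) = transpose_mat Q $$ (j, i)" "?C $$ (i, j) = transpose_mat ?C $$ (j, i)"
        using ij carrier_matD[OF Q(1)] carrier_matD[OF C(1)] by auto
      then show ?thesis unfolding Q(2) C(2) using le[of j i] ij False by simp
    qed (use le ij in auto)
  qed (use carrier_matD[OF Q(1)] carrier_matD[OF C(1)] in auto)
  with l show thesis by (rule that[of "\<lambda>i. l i i" "\<lambda>(i, j). l i j"])
qed

section \<open>Attainment of the minimum and its comparison with the diagonal\<close>

lemma tri_form_coord_bound:
  assumes b: "\<And>i. i < d \<Longrightarrow> 0 < b i" and k: "k < d"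
  shows "\<exists>C. \<forall>a. tri_form d b u a \<le> R \<longrightarrow> \<bar>a k\<bar> \<le> C"
  using k
\<comment> \<open>Back substitution from the last coordinate: component k of L a has absolute value
  at most sqrt R, and its terms beyond \<open>b k * a k\<close> are bounded already.\<close>
proof (induction "d - k" arbitrary: k rule: less_induct)
  case less
  have "\<forall>j\<in>{k<..<d}. \<exists>C. \<forall>a. tri_form d b u a \<le> R \<longrightarrow> \<bar>a j\<bar> \<le> C"
    using less.hyps by auto
  then obtain C where C: "\<And>j a. j \<in> {k<..<d} \<Longrightarrow> tri_form d b u a \<le> R \<Longrightarrow> \<bar>a j\<bar> \<le> C j"
    by metis
  have bk: "0 < b k" using b less.prems by simp
  show ?case
  proof (intro exI allI impI)
    fix a assume a: "tri_form d b u a \<le> R"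
    let ?s = "\<Sum>j\<in>{k<..<d}. u (k, j) * a j"
    have "(b k * a k + ?s)\<^sup>2 \<le> tri_form d b u a" unfolding tri_form_def
      using less.prems by (intro member_le_sum[of k "{..<d}" "\<lambda>i. (b i * a i + (\<Sum>j\<in>{i<..<d}. u (i, j) * a j))\<^sup>2"]) auto
    then have "\<bar>b k * a k + ?s\<bar> \<le> sqrt R" using a by (simp add: real_le_rsqrt)
    moreover have "\<bar>?s\<bar> \<le> (\<Sum>j\<in>{k<..<d}. \<bar>u (k, j)\<bar> * C j)"
    proof -
      have "\<bar>?s\<bar> \<le> (\<Sum>j\<in>{k<..<d}. \<bar>u (k, j) * a j\<bar>)" by (rule sum_abs)
      also have "\<dots> \<le> (\<Sum>j\<in>{k<..<d}. \<bar>u (k, j)\<bar> * C j)"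
        using C a by (intro sum_mono) (auto simp: abs_mult intro!: mult_left_mono)
      finally show ?thesis .
    qed
    ultimately have "\<bar>b k * a k\<bar> \<le> sqrt R + (\<Sum>j\<in>{k<..<d}. \<bar>u (k, j)\<bar> * C j)" by linarith
    then show "\<bar>a k\<bar> \<le> (sqrt R + (\<Sum>j\<in>{k<..<d}. \<bar>u (k, j)\<bar> * C j)) / b k"
      using bk by (simp add: abs_mult field_simps)
  qed
qed

lemma finite_int_vec_tri_form_le:
  assumes b: "\<And>i. i < d \<Longrightarrow> 0 < b i"
  shows "finite {a :: int vec. a \<in> carrier_vec d \<and> tri_form d b u (\<lambda>i. real_of_int (a $ i)) \<le> R}" (is "finite ?A")
proof -
  have "\<forall>k\<in>{..<d}. \<exists>C. \<forall>a. tri_form d b u a \<le> R \<longrightarrow> \<bar>a k\<bar> \<le> C"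
    using tri_form_coord_bound[OF b] by auto
  then obtain C where C: "\<And>k a. k < d \<Longrightarrow> tri_form d b u a \<le> R \<Longrightarrow> \<bar>a k\<bar> \<le> C k" by (metis lessThan_iff)
  \<comment> \<open>One bound for all coordinates. The absolute values keep every summand
    nonnegative, so the sum dominates each of them.\<close>
  define N where "N = (\<Sum>k<d. \<lceil>\<bar>C k\<bar>\<rceil>)"
  have N: "C k \<le> real_of_int N" if "k < d" for k
  proof -
    have "\<lceil>\<bar>C k\<bar>\<rceil> \<le> N" unfolding N_def using that by (intro member_le_sum) auto
    then show ?thesis by linarith
  qed
  have "?A \<subseteq> vec_of_list ` {xs. set xs \<subseteq> {-N..N} \<and> length xs = d}"
  proof
    fix a assume a: "a \<in> ?A"
    have "\<bar>a $ k\<bar> \<le> N" if "k < d" for k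
    proof -
      have "\<bar>real_of_int (a $ k)\<bar> \<le> C k" using C[OF that, of "\<lambda>i. real_of_int (a $ i)"] a by simp
      then have "real_of_int \<bar>a $ k\<bar> \<le> real_of_int N" using N[OF that] by simp
      then show ?thesis by linarith
    qed
    then have "set (list_of_vec a) \<subseteq> {-N..N}" using a
      by (auto simp: set_list_of_vec vec_set_def abs_le_iff) (metis minus_le_iff)+
    moreover have "length (list_of_vec a) = d" using a by simp
    ultimately show "a \<in> vec_of_list ` {xs. set xs \<subseteq> {-N..N} \<and> length xs = d}"
      by (intro image_eqI[of _ _ "list_of_vec a"]) (auto simp: vec_list)
  qed
  moreover have "finite {xs. set xs \<subseteq> {-N..N} \<and> length xs = d}" by (rule finite_lists_length_eq) simp
  ultimately show ?thesis by (rule finite_subset[OF _ finite_imageI])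
qed

text \<open>In a linear order that is not a well-order, \<open>LEAST\<close> may have nothing to
  pick. If only finitely many values satisfying \<open>P\<close> lie at or below one such value,
  their minimum is the least of all.\<close>

lemma Least_attained:
  fixes P :: "'a :: linorder \<Rightarrow> bool"
  assumes "finite {m. P m \<and> m \<le> m0}" "P m0"
  shows "P (Least P)" "\<And>m. P m \<Longrightarrow> Least P \<le> m"
proof -
  let ?M = "{m. P m \<and> m \<le> m0}"
  have ne: "?M \<noteq> {}" using assms(2) by auto
  have "Min ?M \<in> ?M" using assms(1) ne by (rule Min_in)
  have lower: "Min ?M \<le> m" if "P m" for m
  proof (cases "m \<le> m0")
    case True
    then show ?thesis using assms(1) that by (intro Min_le) auto
  next
    case False
    then show ?thesis using \<open>Min ?M \<in> ?M\<close> by auto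
  qed
  then have "Least P = Min ?M" using \<open>Min ?M \<in> ?M\<close> by (intro Least_equality) auto
  then show "P (Least P)" "\<And>m. P m \<Longrightarrow> Least P \<le> m" using lower \<open>Min ?M \<in> ?M\<close> by auto
qed

text \<open>Attainment turns the event into the existence of an integer vector with a small form
  value. Both bounds rest on this, and so, by countability, does measurability.\<close>

lemma min_form_chol_le_iff:
  assumes d: "0 < d" and b: "\<And>i. i < d \<Longrightarrow> 0 < b i"
  shows "min_form d (chol (tri_mat d b u)) \<le> \<delta> \<longleftrightarrow>
    (\<exists>a :: int vec. a \<in> carrier_vec d \<and> a \<noteq> 0\<^sub>v d \<and> tri_form d b u (\<lambda>i. real_of_int (a $ i)) \<le> \<delta>)"
proof -
  define F where "F = (\<lambda>a :: int vec. tri_form d b u (\<lambda>i. real_of_int (a $ i)))"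
  define P where "P = (\<lambda>m. \<exists>a :: int vec. a \<in> carrier_vec d \<and> a \<noteq> 0\<^sub>v d \<and> m = F a)"
  have form: "scalar_prod (map_vec real_of_int a) (chol (tri_mat d b u) *\<^sub>v map_vec real_of_int a) = F a"
    if "a \<in> carrier_vec d" for a :: "int vec"
  proof -
    have "tri_form d b u (\<lambda>i. map_vec real_of_int a $ i) = F a"
      unfolding F_def tri_form_def using that by (intro sum.cong arg_cong[of _ _ "\<lambda>x. x\<^sup>2"] arg_cong2[of _ _ _ _ "(+)"]) auto
    then show ?thesis using chol_tri_mat_form[of "map_vec real_of_int a" d b u] that by simp
  qed
  have min: "min_form d (chol (tri_mat d b u)) = Least P"
    unfolding min_form_def P_def using form by (intro arg_cong[of _ _ Least] ext) auto
  \<comment> \<open>Any nonzero integer vector can supply the reference value; only finitely many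
    vectors have a form value not exceeding it.\<close>
  have "unit_vec d 0 \<in> carrier_vec d" "unit_vec d 0 \<noteq> (0\<^sub>v d :: int vec)" using d by auto
  then have P0: "P (F (unit_vec d 0))" unfolding P_def by blast
  have "{m. P m \<and> m \<le> F (unit_vec d 0)} \<subseteq> F ` {a :: int vec. a \<in> carrier_vec d \<and> F a \<le> F (unit_vec d 0)}"
    by (auto simp: P_def)
  then have "finite {m. P m \<and> m \<le> F (unit_vec d 0)}"
    using finite_int_vec_tri_form_le[OF b, where d=d and u=u and R="F (unit_vec d 0)"] unfolding F_def
    by (auto intro: finite_subset)
  note attained = Least_attained[of P, OF this P0]
  have "Least P \<le> \<delta> \<longleftrightarrow> (\<exists>m. P m \<and> m \<le> \<delta>)"
    using attained by (auto intro: order_trans)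
  also have "\<dots> \<longleftrightarrow> (\<exists>a :: int vec. a \<in> carrier_vec d \<and> a \<noteq> 0\<^sub>v d \<and> F a \<le> \<delta>)"
    by (auto simp: P_def)
  finally show ?thesis by (simp add: min F_def)
qed

lemma min_form_chol_le_of_first:
  assumes d: "0 < d" and b: "\<And>i. i < d \<Longrightarrow> 0 < b i" and "b 0 \<le> sqrt \<delta>"
  shows "min_form d (chol (tri_mat d b u)) \<le> \<delta>"
proof -
  \<comment> \<open>Column 0 of an upper triangular matrix has no entry besides the diagonal
    one.\<close>
  have "tri_form d b u (\<lambda>i. real_of_int (unit_vec d 0 $ i)) = (\<Sum>i<d. if i = 0 then (b 0)\<^sup>2 else 0)"
    unfolding tri_form_def
  proof (rule sum.cong)
    fix i assume i: "i \<in> {..<d}"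
    have "(\<Sum>j\<in>{i<..<d}. u (i, j) * real_of_int (unit_vec d 0 $ j)) = 0"
      by (intro sum.neutral) auto
    then show "(b i * real_of_int (unit_vec d 0 $ i) + (\<Sum>j\<in>{i<..<d}. u (i, j) * real_of_int (unit_vec d 0 $ j)))\<^sup>2 = (if i = 0 then (b 0)\<^sup>2 else 0)"
      using i by auto
  qed simp
  also have "\<dots> = (b 0)\<^sup>2" using d by simp
  also have "\<dots> \<le> \<delta>"
  proof -
    \<comment> \<open>This yields 0 < \<delta>, so that squaring the root gives \<delta> back;
      \<open>sqrt\<close> of a negative number is negative.\<close>
    have "0 < sqrt \<delta>" using assms(3) b[OF d] by linarith
    moreover have "(b 0)\<^sup>2 \<le> (sqrt \<delta>)\<^sup>2" using assms(3) b[OF d] by (intro power_mono) auto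
    ultimately show ?thesis by simp
  qed
  finally show ?thesis
    using d by (intro min_form_chol_le_iff[where b=b, OF d b, THEN iffD2] exI[of _ "unit_vec d 0"]) auto
qed

lemma min_form_chol_gt:
  assumes d: "0 < d" and \<delta>: "0 < \<delta>" and b: "\<And>i. i < d \<Longrightarrow> sqrt \<delta> < b i"
  shows "\<not> min_form d (chol (tri_mat d b u)) \<le> \<delta>"
proof
  assume le: "min_form d (chol (tri_mat d b u)) \<le> \<delta>"
  have pos: "0 < b i" if "i < d" for i using b[OF that] \<delta> by (meson order.strict_trans real_sqrt_gt_zero)
  obtain a :: "int vec" where a: "a \<in> carrier_vec d" "a \<noteq> 0\<^sub>v d" "tri_form d b u (\<lambda>i. real_of_int (a $ i)) \<le> \<delta>"
    using min_form_chol_le_iff[where b=b, OF d pos, THEN iffD1, OF _ le] by blast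
  obtain k where k: "k < d" "a $ k \<noteq> 0" "\<And>j. k < j \<Longrightarrow> j < d \<Longrightarrow> a $ j = 0"
    using last_nonzero_index[OF a(1,2)] by metis
  have "\<delta> = (sqrt \<delta>)\<^sup>2" using \<delta> by simp
  also have "\<dots> < (b k)\<^sup>2" using b[OF k(1)] \<delta> by (intro power_strict_mono) auto
  also have "\<dots> \<le> (b k)\<^sup>2 * (real_of_int (a $ k))\<^sup>2"
  proof -
    \<comment> \<open>Integrality enters here: a nonzero integer has square at least 1.\<close>
    have "1 \<le> (a $ k)\<^sup>2" using k(2) by (simp add: int_one_le_iff_zero_less)
    then have "1 \<le> (real_of_int (a $ k))\<^sup>2" by (metis of_int_1_le_iff of_int_power)
    then show ?thesis by (simp add: mult_le_cancel_left1)
  qed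
  also have "\<dots> = (b k * real_of_int (a $ k))\<^sup>2" by (simp add: power_mult_distrib)
  also have "\<dots> \<le> tri_form d b u (\<lambda>i. real_of_int (a $ i))"
    using k by (intro tri_form_lower) auto
  finally show False using a(3) by simp
qed

subsection \<open>Separating the diagonal\<close>

text \<open>Both measures give a box the product of the measures of its factors. The lemma serves to
  index the diagonal by i instead of by the position (i, i).\<close>

lemma leb_reindex:
  assumes fin: "finite K" and inj: "inj_on t K"
  shows "leb (t ` K) = distr (leb K) (leb (t ` K)) (\<lambda>\<beta>. \<lambda>i\<in>t ` K. \<beta> (the_inv_into K t i))"
proof -
  let ?r = "\<lambda>\<beta>. \<lambda>i\<in>t ` K. \<beta> (the_inv_into K t i)"
  have mr: "?r \<in> leb K \<rightarrow>\<^sub>M leb (t ` K)"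
    by (rule measurable_into_leb) (auto intro!: measurable_leb_component simp: the_inv_into_f_f[OF inj])
  have "distr (leb K) (leb (t ` K)) ?r = Pi\<^sub>M (t ` K) (\<lambda>_. lborel)"
  proof (rule product_sigma_finite.PiM_eqI[OF product_sigma_finite_lborel])
    show "finite (t ` K)" using fin by simp
    show "sets (distr (leb K) (leb (t ` K)) ?r) = sets (Pi\<^sub>M (t ` K) (\<lambda>_. lborel))" by (simp add: leb_def)
    fix A :: "'b \<Rightarrow> real set" assume A: "\<And>i. i \<in> t ` K \<Longrightarrow> A i \<in> sets lborel"
    have PA: "Pi\<^sub>E (t ` K) A \<in> sets (leb (t ` K))"
      unfolding leb_def using A fin by (intro sets_PiM_I_finite) auto
    have "?r -` Pi\<^sub>E (t ` K) A \<inter> space (leb K) = Pi\<^sub>E K (\<lambda>i. A (t i))"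
      by (auto simp: space_leb PiE_def Pi_iff the_inv_into_f_f[OF inj])
    then have "emeasure (distr (leb K) (leb (t ` K)) ?r) (Pi\<^sub>E (t ` K) A) = emeasure (leb K) (Pi\<^sub>E K (\<lambda>i. A (t i)))"
      by (simp add: emeasure_distr[OF mr PA])
    also have "\<dots> = (\<Prod>i\<in>K. emeasure lborel (A (t i)))"
      unfolding leb_def using A fin
      by (intro product_sigma_finite.emeasure_PiM[OF product_sigma_finite_lborel]) auto
    also have "\<dots> = (\<Prod>i\<in>t ` K. emeasure lborel (A i))"
      using inj by (simp add: prod.reindex)
    finally show "emeasure (distr (leb K) (leb (t ` K)) ?r) (Pi\<^sub>E (t ` K) A) = (\<Prod>i\<in>t ` K. emeasure lborel (A i))" .
  qed
  then show ?thesis by (simp add: leb_def)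
qed

definition join_diag :: "nat \<Rightarrow> nat \<Rightarrow> (nat \<Rightarrow> real) \<Rightarrow> (nat \<times> nat \<Rightarrow> real) \<Rightarrow> (nat \<times> nat \<Rightarrow> real)" where
  "join_diag d k \<beta> u = (\<lambda>(i, j)\<in>(\<lambda>i. (i, i)) ` {..<k} \<union> strict_idx d. if i = j then \<beta> i else u (i, j))"

lemma finite_strict_idx: "finite (strict_idx d)"
  by (rule finite_subset[of _ "{..<d} \<times> {..<d}"]) (auto simp: strict_idx_def)

lemma join_diag_measurable:
  "(\<lambda>(\<beta>, u). join_diag d k \<beta> u) \<in> leb {..<k} \<Otimes>\<^sub>M leb (strict_idx d) \<rightarrow>\<^sub>M leb ((\<lambda>i. (i, i)) ` {..<k} \<union> strict_idx d)"
proof (rule measurable_into_leb)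
  fix e :: "nat \<times> nat" assume e: "e \<in> (\<lambda>i. (i, i)) ` {..<k} \<union> strict_idx d"
  show "(\<lambda>x. (case x of (\<beta>, u) \<Rightarrow> join_diag d k \<beta> u) e) \<in> borel_measurable (leb {..<k} \<Otimes>\<^sub>M leb (strict_idx d))"
  proof (cases "fst e = snd e")
    case True
    then have i: "fst e \<in> {..<k}" using e by (auto simp: strict_idx_def)
    have "(\<lambda>x. (case x of (\<beta>, u) \<Rightarrow> join_diag d k \<beta> u) e) = (\<lambda>x. fst x (fst e))"
      using True e by (auto simp: join_diag_def fun_eq_iff case_prod_beta)
    then show ?thesis using measurable_compose[OF measurable_fst measurable_leb_component[OF i]] by simp
  next
    case False
    then have i: "e \<in> strict_idx d" using e by auto
    have "(\<lambda>x. (case x of (\<beta>, u) \<Rightarrow> join_diag d k \<beta> u) e) = (\<lambda>x. snd x e)"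
      using False e by (auto simp: join_diag_def fun_eq_iff case_prod_beta)
    then show ?thesis using measurable_compose[OF measurable_snd measurable_leb_component[OF i]] by simp
  qed
qed (auto simp: join_diag_def)

text \<open>Tonelli's theorem between the diagonal and the strict upper part, followed by the
  renaming of the diagonal positions.\<close>

lemma nn_integral_leb_join_diag:
  fixes h :: "(nat \<times> nat \<Rightarrow> real) \<Rightarrow> ennreal"
  assumes h: "h \<in> borel_measurable (leb ((\<lambda>i. (i, i)) ` {..<k} \<union> strict_idx d))"
  shows "(\<integral>\<^sup>+x. h x \<partial>leb ((\<lambda>i. (i, i)) ` {..<k} \<union> strict_idx d))
    = (\<integral>\<^sup>+\<beta>. \<integral>\<^sup>+u. h (join_diag d k \<beta> u) \<partial>leb (strict_idx d) \<partial>leb {..<k})"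
proof -
  let ?t = "\<lambda>i::nat. (i, i)" and ?S = "strict_idx d"
  let ?E = "?t ` {..<k}"
  let ?r = "\<lambda>\<beta>. \<lambda>i\<in>?E. \<beta> (the_inv_into {..<k} ?t i)"
  have inj: "inj_on ?t {..<k}" by (auto simp: inj_on_def)
  have hm: "h \<in> borel_measurable (Pi\<^sub>M (?E \<union> ?S) (\<lambda>_. lborel))" using h by (simp add: leb_def)
  have "(\<integral>\<^sup>+x. h x \<partial>leb (?E \<union> ?S)) = (\<integral>\<^sup>+x. \<integral>\<^sup>+u. h (merge ?E ?S (x, u)) \<partial>leb ?S \<partial>leb ?E)"
    unfolding leb_def
    by (rule product_sigma_finite.product_nn_integral_fold[OF product_sigma_finite_lborel])
      (use hm finite_strict_idx in \<open>auto simp: strict_idx_def\<close>)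
  also have "\<dots> = (\<integral>\<^sup>+\<beta>. \<integral>\<^sup>+u. h (merge ?E ?S (?r \<beta>, u)) \<partial>leb ?S \<partial>leb {..<k})"
  proof (subst leb_reindex[OF finite_lessThan inj], rule nn_integral_distr)
    show "?r \<in> leb {..<k} \<rightarrow>\<^sub>M leb ?E"
      by (rule measurable_into_leb) (auto intro!: measurable_leb_component simp: the_inv_into_f_f[OF inj])
    have "(\<lambda>p. h (merge ?E ?S p)) \<in> borel_measurable (leb ?E \<Otimes>\<^sub>M leb ?S)"
      using measurable_compose[OF measurable_merge[of ?E ?S "\<lambda>_. lborel"] hm] by (simp add: leb_def)
    then have "(\<lambda>(x, u). h (merge ?E ?S (x, u))) \<in> borel_measurable (leb ?E \<Otimes>\<^sub>M leb ?S)"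
      by (simp add: case_prod_beta)
    then have "(\<lambda>x. \<integral>\<^sup>+u. h (merge ?E ?S (x, u)) \<partial>leb ?S) \<in> borel_measurable (leb ?E)"
      by (rule sigma_finite_measure.borel_measurable_nn_integral[OF sigma_finite_leb[OF finite_strict_idx]])
    then show "(\<lambda>x. \<integral>\<^sup>+u. h (merge ?E ?S (x, u)) \<partial>leb ?S) \<in> borel_measurable (distr (leb {..<k}) (leb ?E) ?r)"
      by simp
  qed
  also have "\<dots> = (\<integral>\<^sup>+\<beta>. \<integral>\<^sup>+u. h (join_diag d k \<beta> u) \<partial>leb ?S \<partial>leb {..<k})"
  proof -
    have "merge ?E ?S (?r \<beta>, u) = join_diag d k \<beta> u" for \<beta> u
    proof
      fix e :: "nat \<times> nat"
      consider (a) i where "i < k" "e = (i, i)" | (b) "e \<in> ?S" "e \<notin> ?E" | (c) "e \<notin> ?S" "e \<notin> ?E" by auto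
      then show "merge ?E ?S (?r \<beta>, u) e = join_diag d k \<beta> u e"
      proof cases
        case a
        then show ?thesis using the_inv_into_f_f[OF inj, of i] by (auto simp: merge_def join_diag_def)
      next
        case b
        then show ?thesis by (auto simp: merge_def join_diag_def strict_idx_def)
      next
        case c
        then show ?thesis by (auto simp: merge_def join_diag_def)
      qed
    qed
    then show ?thesis by simp
  qed
  finally show ?thesis .
qed

subsection \<open>The distribution of the minimum\<close>

lemma entries_chol_tri_mat:
  assumes "\<And>i. (i, i) \<in> key_idx d n \<Longrightarrow> b i = x (i, i)"
  shows "entries (key_idx d n) (chol (tri_mat d b x)) = chol_entries (key_idx d n) x"
proof
  fix e
  show "entries (key_idx d n) (chol (tri_mat d b x)) e = chol_entries (key_idx d n) x e"
  proof (cases "e \<in> key_idx d n")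
    case False
    then show ?thesis by (simp add: entries_def chol_entries_def)
  next
    case True
    obtain i j where e: "e = (i, j)" by force
    have ij: "i \<le> j" "j < d" using True e by (auto simp: key_idx_def)
    \<comment> \<open>Only diagonal positions in the index set are read. In the determinant 1 case
      the bottom right entry of the factor therefore does not affect the retained entries.\<close>
    have "b i = x (i, i)" using True e by (intro assms key_idx_closed(1)[of i j]) auto
    then show ?thesis using True ij unfolding e
      by (auto simp: entries_def chol_entries_def chol_tri_mat_index intro!: sum.cong)
  qed
qed

lemma tri_mat_param_image:
  "(\<lambda>x. chol (tri_mat d (\<lambda>i. x (i, i)) x)) ` pos_diag (upper_idx d) = spd d"
proof (intro Set.set_eqI iffI)
  fix Q assume "Q \<in> (\<lambda>x. chol (tri_mat d (\<lambda>i. x (i, i)) x)) ` pos_diag (upper_idx d)"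
  then obtain x where x: "x \<in> pos_diag (upper_idx d)" "Q = chol (tri_mat d (\<lambda>i. x (i, i)) x)" by auto
  then have "0 < x (i, i)" if "i < d" for i using that by (simp add: pos_diag_def upper_idx_def)
  then show "Q \<in> spd d" unfolding x(2) by (rule chol_tri_mat_spd)
next
  fix Q assume "Q \<in> spd d"
  then obtain b u where bu: "\<And>i. i < d \<Longrightarrow> 0 < b i" "Q = chol (tri_mat d b u)" by (rule cholesky_exists) blast
  define x where "x = restrict (\<lambda>(i, j). if i = j then b i else u (i, j)) (upper_idx d)"
  have "tri_mat d (\<lambda>i. x (i, i)) x = tri_mat d b u"
    by (rule tri_mat_cong) (auto simp: x_def upper_idx_def)
  moreover have "x \<in> pos_diag (upper_idx d)" using bu(1) by (auto simp: pos_diag_def space_leb x_def upper_idx_def)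
  ultimately show "Q \<in> (\<lambda>x. chol (tri_mat d (\<lambda>i. x (i, i)) x)) ` pos_diag (upper_idx d)"
    using bu(2) by (intro image_eqI[of _ _ x]) auto
qed

text \<open>The determinant is the square of the product of the diagonal of the factor. This product
  is positive, so determinant 1 forces it to be 1, and the last diagonal entry is the reciprocal of
  the product of the others.\<close>

lemma tri_mat1_param_image:
  assumes d: "1 \<le> d"
  shows "(\<lambda>x. chol (tri_mat1 d (\<lambda>i. x (i, i)) x)) ` pos_diag (upper_idx1 d) = spd1 d"
proof (intro Set.set_eqI iffI)
  have split: "(\<Prod>i<d. g i) = (\<Prod>i<d - 1. g i) * g (d - 1)" for g :: "nat \<Rightarrow> real"
    using d by (cases d) auto
  {
    fix Q assume "Q \<in> (\<lambda>x. chol (tri_mat1 d (\<lambda>i. x (i, i)) x)) ` pos_diag (upper_idx1 d)"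
    then obtain x where x: "x \<in> pos_diag (upper_idx1 d)" "Q = chol (tri_mat1 d (\<lambda>i. x (i, i)) x)" by auto
    let ?b = "(\<lambda>i. x (i, i))(d - 1 := 1 / (\<Prod>i<d - 1. x (i, i)))"
    have pos: "0 < x (i, i)" if "i < d - 1" for i
      using that x(1) by (auto simp: pos_diag_def upper_idx_def upper_idx1_def)
    then have P: "0 < (\<Prod>i<d - 1. x (i, i))" by (intro prod_pos) auto
    have "0 < ?b i" if "i < d" for i using that pos[of i] P by auto
    then have "Q \<in> spd d" unfolding x(2) tri_mat1_def by (rule chol_tri_mat_spd)
    moreover have "(\<Prod>i<d. ?b i) = 1" unfolding split using pos by (simp add: less_imp_neq[symmetric])
    then have "Determinant.det Q = 1" unfolding x(2) tri_mat1_def det_chol_tri_mat by simp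
    ultimately show "Q \<in> spd1 d" by (simp add: spd1_def)
  next
    fix Q assume Q: "Q \<in> spd1 d"
    then obtain b u where bu: "\<And>i. i < d \<Longrightarrow> 0 < b i" "Q = chol (tri_mat d b u)"
      unfolding spd1_def using cholesky_exists[of Q d] by blast
    have P: "0 < (\<Prod>i<d. b i)" using bu(1) by (intro prod_pos) auto
    have "(\<Prod>i<d. b i)\<^sup>2 = 1" using Q by (simp add: spd1_def bu(2) det_chol_tri_mat)
    then have "(\<Prod>i<d. b i) = 1" using P by (simp add: power2_eq_1_iff)
    moreover have "0 < (\<Prod>i<d - 1. b i)" using bu(1) by (intro prod_pos) auto
    ultimately have last: "b (d - 1) = 1 / (\<Prod>i<d - 1. b i)"
      unfolding split by (metis eq_divide_imp less_irrefl mult.commute)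
    define x where "x = restrict (\<lambda>(i, j). if i = j then b i else u (i, j)) (upper_idx1 d)"
    have xi: "x (i, i) = b i" if "i < d - 1" for i using that by (auto simp: x_def upper_idx1_def upper_idx_def)
    have "tri_mat1 d (\<lambda>i. x (i, i)) x = tri_mat d b u" unfolding tri_mat1_def
    proof (rule tri_mat_cong)
      show "((\<lambda>i. x (i, i))(d - 1 := 1 / (\<Prod>i<d - 1. x (i, i)))) i = b i" if "i < d" for i
        using that xi last by (cases "i = d - 1") auto
    qed (auto simp: x_def upper_idx1_def upper_idx_def)
    moreover have "x \<in> pos_diag (upper_idx1 d)"
      using bu(1) by (auto simp: pos_diag_def space_leb x_def upper_idx_def upper_idx1_def)
    ultimately show "Q \<in> (\<lambda>x. chol (tri_mat1 d (\<lambda>i. x (i, i)) x)) ` pos_diag (upper_idx1 d)"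
      using bu(2) by (intro image_eqI[of _ _ x]) auto
  }
qed

lemma countable_carrier_vec: "countable {a :: 'a :: countable vec. a \<in> carrier_vec d}"
proof (rule countable_subset)
  show "{a :: 'a vec. a \<in> carrier_vec d} \<subseteq> range vec_of_list"
    by (metis subsetI rangeI vec_list)
qed simp

text \<open>Here \<open>a\<close> is meant as the probability of the event and \<open>c1\<close>,
  \<open>c2\<close> as the masses of two sets of diagonals. The hypotheses avoid subtraction and
  force all three to be finite. The differences are taken in \<open>ereal\<close>, where 0 \<le> 1 -
  c has content and is not an effect of truncation.\<close>

lemma ereal_bounds_of_ennreal:
  fixes a c1 c2 :: ennreal
  assumes "c1 \<le> 1" "1 \<le> c1 + a" "a + c2 \<le> 1"
  shows "0 \<le> 1 - enn2ereal c1" "1 - enn2ereal c1 \<le> ereal (enn2real a)"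
    "ereal (enn2real a) \<le> 1 - enn2ereal c2" "1 - enn2ereal c2 \<le> 1"
proof -
  have "a \<le> 1" "c2 \<le> 1" using assms(3) by (metis add_increasing2 order_trans zero_le order_refl add.commute)+
  then obtain ra r1 r2 where r: "a = ennreal ra" "0 \<le> ra" "c1 = ennreal r1" "0 \<le> r1" "c2 = ennreal r2" "0 \<le> r2"
    using assms(1) by (metis ennreal_cases neq_top_trans ennreal_one_neq_top)
  have "1 \<le> r1 + ra" using assms(2) r by (simp add: ennreal_plus[symmetric] del: ennreal_plus)
  moreover have "ra + r2 \<le> 1" using assms(3) r by (simp add: ennreal_plus[symmetric] del: ennreal_plus)
  moreover have "r1 \<le> 1" using assms(1) r by simp
  ultimately show "0 \<le> 1 - enn2ereal c1" "1 - enn2ereal c1 \<le> ereal (enn2real a)"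
    "ereal (enn2real a) \<le> 1 - enn2ereal c2" "1 - enn2ereal c2 \<le> 1"
    using r by (simp_all add: one_ereal_def enn2ereal_ennreal)
qed

text \<open>The last diagonal entry is free in one half of the theorem and determined by the others in the
  other half: \<open>bb\<close> completes the \<open>k\<close> free diagonal entries to all \<open>d\<close> of them.\<close>

locale cholesky_param =
  fixes d k n :: nat and I :: "(nat \<times> nat) set" and X :: "real mat set" and bb :: "(nat \<Rightarrow> real) \<Rightarrow> nat \<Rightarrow> real" 
    and \<Phi> :: "(nat \<times> nat \<Rightarrow> real) \<Rightarrow> real mat" and f :: "real mat \<Rightarrow> real"
  assumes k: "1 \<le> k" "k \<le> d" and I_key: "I = key_idx d n"
    and I_Sigma: "I = (SIGMA i:{..<k}. {i..<d})"
    and I_join: "I = (\<lambda>i. (i, i)) ` {..<k} \<union> strict_idx d"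
    and \<Phi>: "\<And>x. \<Phi> x = chol (tri_mat d (bb (\<lambda>i. x (i, i))) x)"
    and img: "\<Phi> ` pos_diag I = X"
    and bb_eq: "\<And>\<beta> i. i < k \<Longrightarrow> bb \<beta> i = \<beta> i"
    and bb_pos: "\<And>\<beta> i. (\<And>i. i < k \<Longrightarrow> 0 < \<beta> i) \<Longrightarrow> i < d \<Longrightarrow> 0 < bb \<beta> i"
    and bb_cong: "\<And>\<beta> \<beta>' i. (\<And>i. i < k \<Longrightarrow> \<beta> i = \<beta>' i) \<Longrightarrow> i < d \<Longrightarrow> bb \<beta> i = bb \<beta>' i"
    and bb_meas: "\<And>i. i < d \<Longrightarrow> (\<lambda>\<beta>. bb \<beta> i) \<in> borel_measurable (leb {..<k})"
    and f: "prob_density (leb_mat I X) f"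
begin

lemma mem_I: "(i, i) \<in> I \<longleftrightarrow> i < k"
  using k by (auto simp: I_Sigma)

lemma mem_I_strict: "i < j \<Longrightarrow> j < d \<Longrightarrow> (i, j) \<in> I"
  by (auto simp: I_join strict_idx_def)

lemma finite_I: "finite I"
  unfolding I_key by (rule finite_key_idx)

lemma subst_I: "subst_rule I (pos_diag I) (chol_entries I) (chol_jac I)"
  unfolding I_key by (rule subst_rule_chol)

lemma entries_\<Phi>: "entries I (\<Phi> x) = chol_entries I x"
  unfolding \<Phi> I_key by (rule entries_chol_tri_mat) (use mem_I bb_eq in \<open>simp add: I_key\<close>)

lemma f_meas: "(\<lambda>Q. ennreal (f Q)) \<in> borel_measurable (leb_mat I X)"
  using f by (simp add: prob_density_def)

lemma diag_measurable: "(\<lambda>x. \<lambda>i\<in>{..<k}. x (i, i)) \<in> leb I \<rightarrow>\<^sub>M leb {..<k}"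
  by (rule measurable_into_leb) (auto intro!: measurable_leb_component simp: mem_I)

text \<open>Measurability of \<open>bb\<close> is given on vectors indexed below \<open>k\<close>.
  The diagonal of \<open>x\<close> is first restricted to these indices, which by
  \<open>bb_cong\<close> changes nothing.\<close>

lemma bb_diag_measurable:
  assumes "i < d"
  shows "(\<lambda>x. bb (\<lambda>i. x (i, i)) i) \<in> borel_measurable (leb I)"
proof -
  have "bb (\<lambda>i. x (i, i)) i = bb (\<lambda>i\<in>{..<k}. x (i, i)) i" for x :: "nat \<times> nat \<Rightarrow> real"
    by (rule bb_cong[OF _ assms]) simp
  then show ?thesis using measurable_compose[OF diag_measurable bb_meas[OF assms]] by simp
qed

lemma bb_diag_pos: "x \<in> pos_diag I \<Longrightarrow> i < d \<Longrightarrow> 0 < bb (\<lambda>i. x (i, i)) i"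
  by (rule bb_pos) (auto simp: pos_diag_def mem_I)

text \<open>Pulled back to the parameters, the event is a countable union, over the nonzero integer
  vectors, of sets on which one measurable form value is at most \<delta>.\<close>

lemma min_form_le_sets: "{Q \<in> X. min_form d Q \<le> \<delta>} \<in> sets (leb_mat I X)"
proof (rule sets_leb_matI[OF subst_I finite_I img entries_\<Phi>])
  let ?C = "{a :: int vec. a \<in> carrier_vec d \<and> a \<noteq> 0\<^sub>v d}"
  let ?t = "\<lambda>a x. tri_form d (bb (\<lambda>i. x (i, i))) x (\<lambda>i. real_of_int (a $ i))"
  have "countable ?C" by (rule countable_subset[OF _ countable_carrier_vec[of d]]) auto
  have "{x \<in> pos_diag I. \<Phi> x \<in> {Q \<in> X. min_form d Q \<le> \<delta>}} = (\<Union>a\<in>?C. {x \<in> pos_diag I. ?t a x \<le> \<delta>})"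
  proof -
    have "min_form d (\<Phi> x) \<le> \<delta> \<longleftrightarrow> (\<exists>a\<in>?C. ?t a x \<le> \<delta>)" if "x \<in> pos_diag I" for x
      unfolding \<Phi>
      using min_form_chol_le_iff[of d "bb (\<lambda>i. x (i, i))" x \<delta>, OF _ bb_diag_pos[OF that]] k by auto
    then show ?thesis using img by auto
  qed
  moreover have "{x \<in> pos_diag I. ?t a x \<le> \<delta>} \<in> sets (leb I)" for a
  proof -
    have [measurable]: "?t a \<in> borel_measurable (leb I)" unfolding tri_form_def
      by (intro borel_measurable_sum borel_measurable_power borel_measurable_add borel_measurable_times
          borel_measurable_const bb_diag_measurable measurable_leb_component mem_I_strict) auto
    have [measurable]: "pos_diag I \<in> sets (leb I)" using subst_I by (simp add: subst_rule_def)
    have "{x \<in> pos_diag I. ?t a x \<le> \<delta>} = {x \<in> space (leb I). x \<in> pos_diag I \<and> ?t a x \<le> \<delta>}"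
      by (auto simp: pos_diag_def)
    then show ?thesis by simp
  qed
  ultimately show "{x \<in> pos_diag I. \<Phi> x \<in> {Q \<in> X. min_form d Q \<le> \<delta>}} \<in> sets (leb I)"
    using \<open>countable ?C\<close> by (auto intro!: sets.countable_UN'')
qed auto

text \<open>The common form of \<open>G_f\<close>, for \<open>k = d\<close> and \<open>bb\<close>
  the identity, and of \<open>G1_f\<close>, for \<open>k = d - 1\<close>.\<close>

definition fibre_density :: "(nat \<Rightarrow> real) \<Rightarrow> ennreal" where
  "fibre_density \<beta> = ennreal (2 ^ k * (\<Prod>i<k. \<beta> i ^ (d - i))) *
     (\<integral>\<^sup>+u. ennreal (f (chol (tri_mat d (bb \<beta>) u))) \<partial>leb (strict_idx d))"

text \<open>The density of the Cholesky coordinates with respect to \<open>leb I\<close>, under the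
  probability measure given by \<open>f\<close>.\<close>

definition weight :: "(nat \<times> nat \<Rightarrow> real) \<Rightarrow> ennreal" where
  "weight x = ennreal (f (\<Phi> x)) * chol_jac I x * indicator (pos_diag I) x"

lemma weight_measurable: "weight \<in> borel_measurable (leb I)"
proof -
  have "(\<lambda>x. ennreal (f (\<Phi> x)) * indicator (pos_diag I) x * chol_jac I x) \<in> borel_measurable (leb I)"
    using subst_I unfolding subst_rule_def
    by (intro borel_measurable_times_ennreal[OF param_compose_measurable[OF subst_I finite_I img entries_\<Phi> f_meas]]) blast
  then show ?thesis unfolding weight_def by (simp add: mult_ac)
qed

lemma weight_integral: "(\<integral>\<^sup>+x. weight x \<partial>leb I) = 1"
  using nn_integral_leb_mat[OF subst_I finite_I img entries_\<Phi> f_meas] f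
  by (simp add: prob_density_def weight_def)

lemma join_diag_mem:
  assumes "\<And>i. i < k \<Longrightarrow> 0 < \<beta> i"
  shows "join_diag d k \<beta> u \<in> pos_diag I"
  using assms by (auto simp: join_diag_def pos_diag_def space_leb I_join strict_idx_def)

lemma weight_join_diag:
  assumes \<beta>: "\<And>i. i < k \<Longrightarrow> 0 < \<beta> i"
  shows "weight (join_diag d k \<beta> u) = ennreal (2 ^ k * (\<Prod>i<k. \<beta> i ^ (d - i))) * ennreal (f (chol (tri_mat d (bb \<beta>) u)))"
proof -
  have diag: "join_diag d k \<beta> u (i, i) = \<beta> i" if "i < k" for i using that by (auto simp: join_diag_def)
  have "tri_mat d (bb (\<lambda>i. join_diag d k \<beta> u (i, i))) (join_diag d k \<beta> u) = tri_mat d (bb \<beta>) u"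
  proof (rule tri_mat_cong)
    show "bb (\<lambda>i. join_diag d k \<beta> u (i, i)) i = bb \<beta> i" if "i < d" for i
      by (rule bb_cong[OF diag that])
  qed (auto simp: join_diag_def strict_idx_def)
  moreover have "chol_jac I (join_diag d k \<beta> u) = ennreal (2 ^ k * (\<Prod>i<k. \<beta> i ^ (d - i)))"
    unfolding I_Sigma using chol_jac_Sigma[of k d "join_diag d k \<beta> u"] k diag \<beta> by simp
  ultimately show ?thesis using join_diag_mem[of \<beta> u, OF \<beta>] by (simp add: weight_def \<Phi> mult.commute)
qed

lemma weight_join_diag_measurable:
  "(\<lambda>(\<beta>, u). weight (join_diag d k \<beta> u)) \<in> borel_measurable (leb {..<k} \<Otimes>\<^sub>M leb (strict_idx d))"
  using measurable_compose[OF join_diag_measurable[of d k, folded I_join] weight_measurable]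
  by (simp add: case_prod_beta)

lemma fibre_density_eq:
  assumes \<beta>: "\<beta> \<in> space (leb {..<k})" and pos: "\<And>i. i < k \<Longrightarrow> 0 < \<beta> i"
  shows "(\<integral>\<^sup>+u. weight (join_diag d k \<beta> u) \<partial>leb (strict_idx d)) = fibre_density \<beta>"
proof -
  \<comment> \<open>Measurability of the fibre integrand is obtained from that of
    \<open>weight\<close>, by dividing by this positive constant.\<close>
  define c where "c = 2 ^ k * (\<Prod>i<k. \<beta> i ^ (d - i))"
  have c: "0 < c" unfolding c_def using pos by (intro mult_pos_pos prod_pos) auto
  have wj: "weight (join_diag d k \<beta> u) = ennreal (2 ^ k * (\<Prod>i<k. \<beta> i ^ (d - i))) * ennreal (f (chol (tri_mat d (bb \<beta>) u)))" for u
    by (rule weight_join_diag) (rule pos)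
  have "(\<lambda>u. weight (join_diag d k \<beta> u)) \<in> borel_measurable (leb (strict_idx d))"
    using measurable_compose[OF measurable_Pair1'[OF \<beta>] weight_join_diag_measurable] by simp
  then have "(\<lambda>u. ennreal (1 / c) * weight (join_diag d k \<beta> u)) \<in> borel_measurable (leb (strict_idx d))"
    by simp
  moreover have "ennreal (1 / c) * weight (join_diag d k \<beta> u) = ennreal (f (chol (tri_mat d (bb \<beta>) u)))" for u
    unfolding wj c_def[symmetric] using c
    by (simp add: mult.assoc[symmetric] ennreal_mult[symmetric])
  ultimately have "(\<lambda>u. ennreal (f (chol (tri_mat d (bb \<beta>) u)))) \<in> borel_measurable (leb (strict_idx d))" by simp
  then show ?thesis unfolding wj fibre_density_def by (rule nn_integral_cmult)
qed

context
  fixes B assumes B: "B \<in> sets (leb {..<k})" and B_pos: "\<And>\<beta> i. \<beta> \<in> B \<Longrightarrow> i < k \<Longrightarrow> 0 < \<beta> i"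
begin

lemma fibre_density_ind_eq:
  assumes "\<beta> \<in> space (leb {..<k})"
  shows "(\<integral>\<^sup>+u. weight (join_diag d k \<beta> u) \<partial>leb (strict_idx d)) * indicator B \<beta> = fibre_density \<beta> * indicator B \<beta>"
  using fibre_density_eq[OF assms] B_pos by (cases "\<beta> \<in> B") auto

lemma fibre_density_measurable: "(\<lambda>\<beta>. fibre_density \<beta> * indicator B \<beta>) \<in> borel_measurable (leb {..<k})"
proof -
  have "(\<lambda>\<beta>. (\<integral>\<^sup>+u. weight (join_diag d k \<beta> u) \<partial>leb (strict_idx d)) * indicator B \<beta>) \<in> borel_measurable (leb {..<k})"
    using B sigma_finite_measure.borel_measurable_nn_integral[OF sigma_finite_leb[OF finite_strict_idx] weight_join_diag_measurable]
    by (intro borel_measurable_times_ennreal borel_measurable_indicator)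
  then show ?thesis by (rule subst[OF measurable_cong, rotated]) (rule fibre_density_ind_eq)
qed

text \<open>Tonelli's theorem over the strict upper part. That \<open>B\<close> contains only
  positive vectors matters: \<open>weight\<close> vanishes off \<open>pos_diag\<close>, whereas
  \<open>fibre_density\<close> need not vanish at other vectors.\<close>

lemma nn_integral_fibre_density:
  "(\<integral>\<^sup>+\<beta>. fibre_density \<beta> * indicator B \<beta> \<partial>leb {..<k})
    = (\<integral>\<^sup>+x. weight x * indicator B (\<lambda>i\<in>{..<k}. x (i, i)) \<partial>leb I)"
proof -
  have mB: "(\<lambda>x. indicator B (\<lambda>i\<in>{..<k}. x (i, i)) :: ennreal) \<in> borel_measurable (leb I)"
    using measurable_compose[OF diag_measurable borel_measurable_indicator[OF B]] .
  have "(\<integral>\<^sup>+x. weight x * indicator B (\<lambda>i\<in>{..<k}. x (i, i)) \<partial>leb I)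
    = (\<integral>\<^sup>+\<beta>. \<integral>\<^sup>+u. weight (join_diag d k \<beta> u) * indicator B (\<lambda>i\<in>{..<k}. join_diag d k \<beta> u (i, i)) \<partial>leb (strict_idx d) \<partial>leb {..<k})"
    using nn_integral_leb_join_diag[OF borel_measurable_times_ennreal[OF weight_measurable mB, unfolded I_join]]
    unfolding I_join .
  also have "\<dots> = (\<integral>\<^sup>+\<beta>. fibre_density \<beta> * indicator B \<beta> \<partial>leb {..<k})"
  proof (rule nn_integral_cong)
    fix \<beta> :: "nat \<Rightarrow> real" assume \<beta>: "\<beta> \<in> space (leb {..<k})"
    have "(\<lambda>i\<in>{..<k}. join_diag d k \<beta> u (i, i)) = \<beta>" for u
      using \<beta> by (auto simp: join_diag_def space_leb extensional_def fun_eq_iff)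
    then have "(\<integral>\<^sup>+u. weight (join_diag d k \<beta> u) * indicator B (\<lambda>i\<in>{..<k}. join_diag d k \<beta> u (i, i)) \<partial>leb (strict_idx d))
      = (\<integral>\<^sup>+u. weight (join_diag d k \<beta> u) * indicator B \<beta> \<partial>leb (strict_idx d))" by simp
    also have "\<dots> = (\<integral>\<^sup>+u. weight (join_diag d k \<beta> u) \<partial>leb (strict_idx d)) * indicator B \<beta>"
      using measurable_compose[OF measurable_Pair1'[OF \<beta>] weight_join_diag_measurable]
      by (intro nn_integral_multc) simp
    also have "\<dots> = fibre_density \<beta> * indicator B \<beta>" by (rule fibre_density_ind_eq[OF \<beta>])
    finally show "(\<integral>\<^sup>+u. weight (join_diag d k \<beta> u) * indicator B (\<lambda>i\<in>{..<k}. join_diag d k \<beta> u (i, i)) \<partial>leb (strict_idx d))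
      = fibre_density \<beta> * indicator B \<beta>" .
  qed
  finally show ?thesis by simp
qed

end

definition first_large :: "real \<Rightarrow> (nat \<Rightarrow> real) set" where
  "first_large \<delta> = {\<beta> \<in> space (leb {..<k}). (\<forall>i<k. 0 < \<beta> i) \<and> sqrt \<delta> < \<beta> 0}"

text \<open>The condition runs over all \<open>d\<close> completed entries, so for
  \<open>k = d - 1\<close> it also constrains the dependent last one.\<close>

definition all_large :: "real \<Rightarrow> (nat \<Rightarrow> real) set" where
  "all_large \<delta> = {\<beta> \<in> space (leb {..<k}). (\<forall>i<k. 0 < \<beta> i) \<and> (\<forall>i<d. sqrt \<delta> < bb \<beta> i)}"

context
  fixes \<delta> :: real assumes \<delta>: "0 < \<delta>"
begin

lemma first_large_sets: "first_large \<delta> \<in> sets (leb {..<k})"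
proof -
  have [measurable]: "(\<lambda>\<beta>. \<beta> i) \<in> borel_measurable (leb {..<k})" if "i \<in> {..<k}" for i
    using measurable_leb_component[OF that] .
  have [measurable]: "(\<lambda>\<beta>. \<beta> 0) \<in> borel_measurable (leb {..<k})"
    using k by (intro measurable_leb_component) simp
  have "{\<beta> \<in> space (leb {..<k}). (\<forall>i\<in>{..<k}. 0 < \<beta> i) \<and> sqrt \<delta> < \<beta> 0} \<in> sets (leb {..<k})"
    by measurable
  then show ?thesis unfolding first_large_def by (simp add: Ball_def)
qed

lemma all_large_sets: "all_large \<delta> \<in> sets (leb {..<k})"
proof -
  have [measurable]: "(\<lambda>\<beta>. \<beta> i) \<in> borel_measurable (leb {..<k})" if "i \<in> {..<k}" for i
    using measurable_leb_component[OF that] .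
  have [measurable]: "(\<lambda>\<beta>. bb \<beta> i) \<in> borel_measurable (leb {..<k})" if "i \<in> {..<d}" for i
    using bb_meas that by simp
  have "{\<beta> \<in> space (leb {..<k}). (\<forall>i\<in>{..<k}. 0 < \<beta> i) \<and> (\<forall>i\<in>{..<d}. sqrt \<delta> < bb \<beta> i)} \<in> sets (leb {..<k})"
    by measurable
  then show ?thesis unfolding all_large_def by (simp add: Ball_def)
qed

text \<open>The inequalities between masses are integrals of pointwise comparisons of
  \<open>weight\<close> times indicators, with total mass 1: a covering of the positive parameters
  gives \<open>1 \<le> c1 + a\<close>, and disjointness gives \<open>a + c2 \<le> 1\<close>.\<close>

lemma min_form_bounds:
  defines "m \<equiv> measure (density (leb_mat I X) (\<lambda>Q. ennreal (f Q))) {Q \<in> X. min_form d Q \<le> \<delta>}"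
    and "c1 \<equiv> \<integral>\<^sup>+\<beta>. fibre_density \<beta> * indicator (first_large \<delta>) \<beta> \<partial>leb {..<k}"
    and "c2 \<equiv> \<integral>\<^sup>+\<beta>. fibre_density \<beta> * indicator (all_large \<delta>) \<beta> \<partial>leb {..<k}"
  shows "0 \<le> 1 - enn2ereal c1" "1 - enn2ereal c1 \<le> ereal m"
    "ereal m \<le> 1 - enn2ereal c2" "1 - enn2ereal c2 \<le> 1"
proof -
  let ?A = "{Q \<in> X. min_form d Q \<le> \<delta>}" and ?diag = "\<lambda>x. \<lambda>i\<in>{..<k}. x (i, i)"
  define a where "a = emeasure (density (leb_mat I X) (\<lambda>Q. ennreal (f Q))) ?A"
  have "(\<lambda>Q. ennreal (f Q) * indicator ?A Q) \<in> borel_measurable (leb_mat I X)"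
    using f_meas min_form_le_sets by (intro borel_measurable_times_ennreal borel_measurable_indicator)
  from nn_integral_leb_mat[OF subst_I finite_I img entries_\<Phi> this]
  have a: "a = (\<integral>\<^sup>+x. weight x * indicator ?A (\<Phi> x) \<partial>leb I)"
    unfolding a_def emeasure_density[OF f_meas min_form_le_sets] weight_def by (simp add: mult_ac)
  \<comment> \<open>Measurability of \<open>\<Phi>\<close> is known on \<open>pos_diag\<close> only,
    so its indicator is inserted here; the one inside \<open>weight\<close> absorbs it
    again.\<close>
  have "(\<lambda>x. indicator ?A (\<Phi> x) * indicator (pos_diag I) x :: ennreal) \<in> borel_measurable (leb I)"
    by (rule param_compose_measurable[OF subst_I finite_I img entries_\<Phi> borel_measurable_indicator[OF min_form_le_sets]])
  then have "(\<lambda>x. weight x * (indicator ?A (\<Phi> x) * indicator (pos_diag I) x)) \<in> borel_measurable (leb I)"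
    by (rule borel_measurable_times_ennreal[OF weight_measurable])
  moreover have "weight x * (indicator ?A (\<Phi> x) * indicator (pos_diag I) x) = weight x * indicator ?A (\<Phi> x)" for x
    by (simp add: weight_def indicator_def)
  ultimately have wA: "(\<lambda>x. weight x * indicator ?A (\<Phi> x)) \<in> borel_measurable (leb I)" by simp
  have wB: "(\<lambda>x. weight x * indicator B (?diag x)) \<in> borel_measurable (leb I)" if "B \<in> sets (leb {..<k})" for B
    by (intro borel_measurable_times_ennreal weight_measurable
        measurable_compose[OF diag_measurable borel_measurable_indicator[OF that]])
  have c1: "c1 = (\<integral>\<^sup>+x. weight x * indicator (first_large \<delta>) (?diag x) \<partial>leb I)"
    unfolding c1_def by (rule nn_integral_fibre_density[OF first_large_sets]) (auto simp: first_large_def)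
  have c2: "c2 = (\<integral>\<^sup>+x. weight x * indicator (all_large \<delta>) (?diag x) \<partial>leb I)"
    unfolding c2_def by (rule nn_integral_fibre_density[OF all_large_sets]) (auto simp: all_large_def)
  have supp: "weight x = 0" if "x \<notin> pos_diag I" for x using that by (simp add: weight_def)
  have "c1 \<le> (\<integral>\<^sup>+x. weight x \<partial>leb I)" unfolding c1
    by (intro nn_integral_mono) (simp add: indicator_def)
  then have 1: "c1 \<le> 1" unfolding weight_integral .
  have "(\<integral>\<^sup>+x. weight x \<partial>leb I) \<le> (\<integral>\<^sup>+x. weight x * indicator (first_large \<delta>) (?diag x) + weight x * indicator ?A (\<Phi> x) \<partial>leb I)"
  proof (rule nn_integral_mono)
    fix x assume "x \<in> space (leb I)"
    show "weight x \<le> weight x * indicator (first_large \<delta>) (?diag x) + weight x * indicator ?A (\<Phi> x)"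
    proof (cases "x \<in> pos_diag I \<and> ?diag x \<notin> first_large \<delta>")
      case True
      then have x: "x \<in> pos_diag I" and "\<not> sqrt \<delta> < x (0, 0)"
        using k by (auto simp: first_large_def space_leb pos_diag_def mem_I)
      then have "bb (\<lambda>i. x (i, i)) 0 \<le> sqrt \<delta>" using bb_eq[of 0] k by simp
      then have "min_form d (\<Phi> x) \<le> \<delta>" unfolding \<Phi>
        using k bb_diag_pos[OF x] by (intro min_form_chol_le_of_first) auto
      then have "\<Phi> x \<in> ?A" using x img by auto
      then show ?thesis by simp
    qed (auto simp: supp)
  qed
  also have "\<dots> = c1 + a" unfolding c1 a
    by (rule nn_integral_add[OF wB[OF first_large_sets] wA])
  finally have 2: "1 \<le> c1 + a" unfolding weight_integral .
  have "a + c2 = (\<integral>\<^sup>+x. weight x * indicator ?A (\<Phi> x) + weight x * indicator (all_large \<delta>) (?diag x) \<partial>leb I)"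
    unfolding c2 a by (rule nn_integral_add[OF wA wB[OF all_large_sets], symmetric])
  also have "\<dots> \<le> (\<integral>\<^sup>+x. weight x \<partial>leb I)"
  proof (rule nn_integral_mono)
    fix x assume "x \<in> space (leb I)"
    show "weight x * indicator ?A (\<Phi> x) + weight x * indicator (all_large \<delta>) (?diag x) \<le> weight x"
    proof (cases "?diag x \<in> all_large \<delta>")
      case True
      have "sqrt \<delta> < bb (\<lambda>i. x (i, i)) i" if "i < d" for i
      proof -
        have "bb (\<lambda>i. x (i, i)) i = bb (?diag x) i" by (rule bb_cong[OF _ that]) simp
        then show ?thesis using True that by (simp add: all_large_def)
      qed
      then have "\<not> min_form d (\<Phi> x) \<le> \<delta>" unfolding \<Phi>
        using k by (intro min_form_chol_gt \<delta>) auto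
      then show ?thesis using True by simp
    qed (simp add: indicator_def)
  qed
  finally have 3: "a + c2 \<le> 1" unfolding weight_integral .
  have "m = enn2real a" by (simp add: m_def a_def measure_def)
  then show "0 \<le> 1 - enn2ereal c1" "1 - enn2ereal c1 \<le> ereal m"
    "ereal m \<le> 1 - enn2ereal c2" "1 - enn2ereal c2 \<le> 1"
    using ereal_bounds_of_ennreal[OF 1 2 3] by simp_all
qed

text \<open>Tonelli's theorem with the first coordinate outermost; above sqrt \<delta> its
  positivity is automatic. For \<open>k = 1\<close> the inner integral is over the one-point space
  and reduces to an evaluation, as required when d = 2 in the determinant 1 case.\<close>

lemma nn_integral_first_large:
  "(\<integral>\<^sup>+\<beta>. fibre_density \<beta> * indicator (first_large \<delta>) \<beta> \<partial>leb {..<k})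
    = (\<integral>\<^sup>+b \<in> {sqrt \<delta><..}. (\<integral>\<^sup>+\<beta> \<in> (\<Pi>\<^sub>E i\<in>{1..<k}. {0<..}). fibre_density (\<beta>(0 := b)) \<partial>leb {1..<k}) \<partial>lborel)"
proof -
  have ins: "{..<k} = insert 0 {1..<k}" using k by auto
  have m: "(\<lambda>\<beta>. fibre_density \<beta> * indicator (first_large \<delta>) \<beta>) \<in> borel_measurable (leb {..<k})"
    by (rule fibre_density_measurable[OF first_large_sets]) (auto simp: first_large_def)
  have "(\<integral>\<^sup>+\<beta>. fibre_density \<beta> * indicator (first_large \<delta>) \<beta> \<partial>leb {..<k})
    = (\<integral>\<^sup>+b. \<integral>\<^sup>+\<beta>. fibre_density (\<beta>(0 := b)) * indicator (first_large \<delta>) (\<beta>(0 := b)) \<partial>leb {1..<k} \<partial>lborel)"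
    using product_sigma_finite.product_nn_integral_insert_rev[OF product_sigma_finite_lborel, of "{1..<k}" 0] m
    unfolding ins leb_def by simp
  also have "\<dots> = (\<integral>\<^sup>+b \<in> {sqrt \<delta><..}. (\<integral>\<^sup>+\<beta> \<in> (\<Pi>\<^sub>E i\<in>{1..<k}. {0<..}). fibre_density (\<beta>(0 := b)) \<partial>leb {1..<k}) \<partial>lborel)"
  proof (rule nn_integral_cong)
    fix b :: real
    have mem: "\<beta>(0 := b) \<in> first_large \<delta> \<longleftrightarrow> \<beta> \<in> (\<Pi>\<^sub>E i\<in>{1..<k}. {0<..}) \<and> sqrt \<delta> < b" if "\<beta> \<in> space (leb {1..<k})" for \<beta>
    proof
      assume "\<beta>(0 := b) \<in> first_large \<delta>"
      then have p: "\<forall>i<k. 0 < (\<beta>(0 := b)) i" "sqrt \<delta> < b" by (auto simp: first_large_def)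
      have "0 < \<beta> i" if "i \<in> {1..<k}" for i using p(1)[rule_format, of i] that by (auto split: if_splits)
      then show "\<beta> \<in> (\<Pi>\<^sub>E i\<in>{1..<k}. {0<..}) \<and> sqrt \<delta> < b" using p that by (auto simp: space_leb PiE_def)
    next
      assume r: "\<beta> \<in> (\<Pi>\<^sub>E i\<in>{1..<k}. {0<..}) \<and> sqrt \<delta> < b"
      then have "0 < b" using \<delta> by (meson order.strict_trans real_sqrt_gt_zero)
      moreover have "0 < \<beta> i" if "i \<in> {1..<k}" for i using r that by (auto simp: PiE_def Pi_iff)
      ultimately show "\<beta>(0 := b) \<in> first_large \<delta>"
        using r that k by (auto simp: first_large_def space_leb extensional_def)
    qed
    show "(\<integral>\<^sup>+\<beta>. fibre_density (\<beta>(0 := b)) * indicator (first_large \<delta>) (\<beta>(0 := b)) \<partial>leb {1..<k})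
      = (\<integral>\<^sup>+\<beta> \<in> (\<Pi>\<^sub>E i\<in>{1..<k}. {0<..}). fibre_density (\<beta>(0 := b)) \<partial>leb {1..<k}) * indicator {sqrt \<delta><..} b"
    proof (cases "sqrt \<delta> < b")
      case True
      then have "(\<integral>\<^sup>+\<beta>. fibre_density (\<beta>(0 := b)) * indicator (first_large \<delta>) (\<beta>(0 := b)) \<partial>leb {1..<k})
        = (\<integral>\<^sup>+\<beta> \<in> (\<Pi>\<^sub>E i\<in>{1..<k}. {0<..}). fibre_density (\<beta>(0 := b)) \<partial>leb {1..<k})"
        by (intro nn_integral_cong) (simp add: indicator_def mem)
      then show ?thesis using True by simp
    next
      case False
      then have "(\<integral>\<^sup>+\<beta>. fibre_density (\<beta>(0 := b)) * indicator (first_large \<delta>) (\<beta>(0 := b)) \<partial>leb {1..<k}) = (\<integral>\<^sup>+\<beta>. 0 \<partial>leb {1..<k})"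
        by (intro nn_integral_cong) (simp add: indicator_def mem)
      then show ?thesis using False by simp
    qed
  qed
  finally show ?thesis .
qed

end

end

lemma upper_idx_join: "upper_idx d = (\<lambda>i. (i, i)) ` {..<d} \<union> strict_idx d"
  by (auto simp: upper_idx_def strict_idx_def le_less)

lemma upper_idx1_join: "upper_idx1 d = (\<lambda>i. (i, i)) ` {..<d - 1} \<union> strict_idx d"
  by (auto simp: upper_idx1_def upper_idx_def strict_idx_def le_less)

section \<open>The two halves of the theorem\<close>

lemma m_f_bounds:
  fixes f :: "real mat \<Rightarrow> real"
  assumes d: "1 \<le> d" and f: "prob_density (leb_spd d) f" and \<delta>: "0 < \<delta>"
  defines "c1 \<equiv> \<integral>\<^sup>+ b \<in> {sqrt \<delta><..}. g_f d f b \<partial>lborel"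
    and "c2 \<equiv> \<integral>\<^sup>+ \<beta> \<in> I_cube d \<delta>. G_f d f \<beta> \<partial>leb {..<d}"
  shows "0 \<le> 1 - enn2ereal c1" "1 - enn2ereal c1 \<le> ereal (m_f d f \<delta>)"
    "ereal (m_f d f \<delta>) \<le> 1 - enn2ereal c2" "1 - enn2ereal c2 \<le> 1"
proof -
  \<comment> \<open>All diagonal entries are coordinates, so the completion \<open>bb\<close> is the
    identity.\<close>
  interpret cholesky_param d d "d * d" "upper_idx d" "spd d" "\<lambda>\<beta>. \<beta>"
    "\<lambda>x. chol (tri_mat d (\<lambda>i. x (i, i)) x)" f
  proof unfold_locales
    show "(\<lambda>\<beta>. \<beta> i) \<in> borel_measurable (leb {..<d})" if "i < d" for i
      using that by (intro measurable_leb_component) simp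
    show "prob_density (leb_mat (upper_idx d) (spd d)) f" using f by (simp add: leb_spd_def)
  qed (fact d order_refl refl upper_idx_eq_key_idx upper_idx_Sigma(1) upper_idx_join tri_mat_param_image | simp)+
  have G: "fibre_density = G_f d f"
    by (simp add: fun_eq_iff fibre_density_def G_f_def)
  have B: "all_large \<delta> = I_cube d \<delta>"
  proof -
    have "0 < x" if "sqrt \<delta> < x" for x using that \<delta> by (meson order.strict_trans real_sqrt_gt_zero)
    then show ?thesis by (auto simp: all_large_def I_cube_def space_leb PiE_def Pi_iff)
  qed
  have "c1 = (\<integral>\<^sup>+\<beta>. fibre_density \<beta> * indicator (first_large \<delta>) \<beta> \<partial>leb {..<d})"
    unfolding c1_def g_f_def G[symmetric] by (rule nn_integral_first_large[OF \<delta>, symmetric])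
  moreover have "c2 = (\<integral>\<^sup>+\<beta>. fibre_density \<beta> * indicator (all_large \<delta>) \<beta> \<partial>leb {..<d})"
    unfolding c2_def G B ..
  moreover have "m_f d f \<delta> = measure (density (leb_mat (upper_idx d) (spd d)) (\<lambda>Q. ennreal (f Q))) {Q \<in> spd d. min_form d Q \<le> \<delta>}"
    by (simp add: m_f_def leb_spd_def)
  ultimately show "0 \<le> 1 - enn2ereal c1" "1 - enn2ereal c1 \<le> ereal (m_f d f \<delta>)"
    "ereal (m_f d f \<delta>) \<le> 1 - enn2ereal c2" "1 - enn2ereal c2 \<le> 1"
    using min_form_bounds[OF \<delta>] by simp_all
qed

lemma m1_f_bounds:
  fixes f :: "real mat \<Rightarrow> real"
  assumes d: "2 \<le> d" and f: "prob_density (leb_spd1 d) f" and \<delta>: "0 < \<delta>"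
  defines "c1 \<equiv> \<integral>\<^sup>+ b \<in> {sqrt \<delta><..}. g1_f d f b \<partial>lborel"
    and "c2 \<equiv> \<integral>\<^sup>+ \<beta> \<in> \<Delta>_dom (d - 1) \<delta>. G1_f d f \<beta> \<partial>leb {..<d - 1}"
  shows "0 \<le> 1 - enn2ereal c1" "1 - enn2ereal c1 \<le> ereal (m1_f d f \<delta>)"
    "ereal (m1_f d f \<delta>) \<le> 1 - enn2ereal c2" "1 - enn2ereal c2 \<le> 1"
proof -
  define bb where "bb = (\<lambda>\<beta> :: nat \<Rightarrow> real. \<beta>(d - 1 := 1 / (\<Prod>i<d - 1. \<beta> i)))"
  have tri_mat1: "tri_mat1 d \<beta> u = tri_mat d (bb \<beta>) u" for \<beta> u
    by (simp add: tri_mat1_def bb_def)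
  have k: "1 \<le> d - 1" "d - 1 \<le> d" using d by auto
  have img: "(\<lambda>x. chol (tri_mat1 d (\<lambda>i. x (i, i)) x)) ` pos_diag (upper_idx1 d) = spd1 d"
    using d by (intro tri_mat1_param_image) simp
  have bb_eq: "bb \<beta> i = \<beta> i" if "i < d - 1" for \<beta> i using that by (simp add: bb_def)
  have bb_pos: "0 < bb \<beta> i" if pos: "\<And>i. i < d - 1 \<Longrightarrow> 0 < \<beta> i" and "i < d" for \<beta> i
  proof (cases "i = d - 1")
    case True
    have "0 < (\<Prod>i<d - 1. \<beta> i)" using pos by (intro prod_pos) auto
    then show ?thesis using True by (simp add: bb_def)
  next
    case False
    then have "i < d - 1" using that(2) by simp
    then show ?thesis using bb_eq pos by simp
  qed
  have bb_cong: "bb \<beta> i = bb \<beta>' i" if eq: "\<And>i. i < d - 1 \<Longrightarrow> \<beta> i = \<beta>' i" and "i < d" for \<beta> \<beta>' i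
  proof (cases "i = d - 1")
    case True
    have "(\<Prod>i<d - 1. \<beta> i) = (\<Prod>i<d - 1. \<beta>' i)" using eq by (intro prod.cong) auto
    then show ?thesis using True by (simp add: bb_def)
  next
    case False
    then have "i < d - 1" using that(2) by simp
    then show ?thesis using bb_eq eq by simp
  qed
  have bb_meas: "(\<lambda>\<beta>. bb \<beta> i) \<in> borel_measurable (leb {..<d - 1})" if "i < d" for i
  proof (cases "i = d - 1")
    case True
    have "(\<lambda>\<beta>. 1 / (\<Prod>i<d - 1. \<beta> i)) \<in> borel_measurable (leb {..<d - 1})"
      by (intro borel_measurable_divide borel_measurable_const borel_measurable_prod measurable_leb_component)
    then show ?thesis using True by (simp add: bb_def)
  next
    case False
    then have "i < d - 1" using that by simp
    then show ?thesis using bb_eq measurable_leb_component[of i "{..<d - 1}"] by simp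
  qed
  interpret cholesky_param d "d - 1" "d * d - 1" "upper_idx1 d" "spd1 d" bb
    "\<lambda>x. chol (tri_mat1 d (\<lambda>i. x (i, i)) x)" f
  proof unfold_locales
    show "chol (tri_mat1 d (\<lambda>i. x (i, i)) x) = chol (tri_mat d (bb (\<lambda>i. x (i, i))) x)" for x
      by (simp add: tri_mat1)
    show "prob_density (leb_mat (upper_idx1 d) (spd1 d)) f" using f by (simp add: leb_spd1_def)
    show "bb \<beta> i = \<beta> i" if "i < d - 1" for \<beta> i using that by (rule bb_eq)
    show "0 < bb \<beta> i" if "\<And>i. i < d - 1 \<Longrightarrow> 0 < \<beta> i" "i < d" for \<beta> i using that by (rule bb_pos)
    show "bb \<beta> i = bb \<beta>' i" if "\<And>i. i < d - 1 \<Longrightarrow> \<beta> i = \<beta>' i" "i < d" for \<beta> \<beta>' i using that by (rule bb_cong)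
    show "(\<lambda>\<beta>. bb \<beta> i) \<in> borel_measurable (leb {..<d - 1})" if "i < d" for i using that by (rule bb_meas)
  qed (fact k upper_idx1_eq_key_idx upper_idx_Sigma(2) upper_idx1_join img)+
  have G: "fibre_density = G1_f d f"
    by (rule ext) (simp only: fibre_density_def G1_f_def tri_mat1)
  have sq: "0 < sqrt \<delta>" using \<delta> by simp
  have B: "all_large \<delta> = \<Delta>_dom (d - 1) \<delta>"
  proof -
    \<comment> \<open>With P the product of the free entries, the last entry is 1 / P, and sqrt
      \<delta> < 1 / P means P < 1 / sqrt \<delta>. This is the origin of the product condition in
      \<open>\<Delta>_dom\<close>.\<close>
    have "(\<forall>i<d. sqrt \<delta> < bb \<beta> i) \<longleftrightarrow> (\<forall>i<d - 1. sqrt \<delta> < \<beta> i) \<and> (\<Prod>i<d - 1. \<beta> i) < 1 / sqrt \<delta>"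
      if pos: "\<forall>i<d - 1. 0 < \<beta> i" for \<beta>
    proof -
      have "0 < (\<Prod>i<d - 1. \<beta> i)" using pos by (intro prod_pos) auto
      then have "sqrt \<delta> < bb \<beta> (d - 1) \<longleftrightarrow> (\<Prod>i<d - 1. \<beta> i) < 1 / sqrt \<delta>"
        using sq by (simp add: bb_def pos_less_divide_eq mult.commute)
      moreover have "(\<forall>i<d. P i) \<longleftrightarrow> (\<forall>i<d - 1. P i) \<and> P (d - 1)" for P
        using d by (cases d) (auto simp: less_Suc_eq)
      ultimately show ?thesis by (simp add: bb_def)
    qed
    then show ?thesis unfolding all_large_def \<Delta>_dom_def by (auto simp: space_leb PiE_def Pi_iff)
  qed
  have "c1 = (\<integral>\<^sup>+\<beta>. fibre_density \<beta> * indicator (first_large \<delta>) \<beta> \<partial>leb {..<d - 1})"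
    unfolding c1_def g1_f_def G[symmetric] by (rule nn_integral_first_large[OF \<delta>, symmetric])
  moreover have "c2 = (\<integral>\<^sup>+\<beta>. fibre_density \<beta> * indicator (all_large \<delta>) \<beta> \<partial>leb {..<d - 1})"
    unfolding c2_def G B ..
  moreover have "m1_f d f \<delta> = measure (density (leb_mat (upper_idx1 d) (spd1 d)) (\<lambda>Q. ennreal (f Q))) {Q \<in> spd1 d. min_form d Q \<le> \<delta>}"
    by (simp add: m1_f_def leb_spd1_def)
  ultimately show "0 \<le> 1 - enn2ereal c1" "1 - enn2ereal c1 \<le> ereal (m1_f d f \<delta>)"
    "ereal (m1_f d f \<delta>) \<le> 1 - enn2ereal c2" "1 - enn2ereal c2 \<le> 1"
    using min_form_bounds[OF \<delta>] by simp_all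
qed

theorem theorem4:
  fixes d :: nat and f ft :: "real mat \<Rightarrow> real" and \<delta> :: real
  assumes "d \<ge> 2"
    and "prob_density (leb_spd d) f"
    and "prob_density (leb_spd1 d) ft"
    and "0 < \<delta>" and "\<delta> < 1"
  shows "((0::ereal) \<le> 1 - enn2ereal (\<integral>\<^sup>+ b \<in> {sqrt \<delta><..}. g_f d f b \<partial>lborel) \<and>
      1 - enn2ereal (\<integral>\<^sup>+ b \<in> {sqrt \<delta><..}. g_f d f b \<partial>lborel) \<le> ereal (m_f d f \<delta>) \<and>
      ereal (m_f d f \<delta>) \<le> 1 - enn2ereal (\<integral>\<^sup>+ \<beta> \<in> I_cube d \<delta>. G_f d f \<beta> \<partial>leb {..<d}) \<and>
      1 - enn2ereal (\<integral>\<^sup>+ \<beta> \<in> I_cube d \<delta>. G_f d f \<beta> \<partial>leb {..<d}) \<le> 1) \<and>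
    ((0::ereal) \<le> 1 - enn2ereal (\<integral>\<^sup>+ b \<in> {sqrt \<delta><..}. g1_f d ft b \<partial>lborel) \<and>
      1 - enn2ereal (\<integral>\<^sup>+ b \<in> {sqrt \<delta><..}. g1_f d ft b \<partial>lborel) \<le> ereal (m1_f d ft \<delta>) \<and>
      ereal (m1_f d ft \<delta>) \<le> 1 - enn2ereal (\<integral>\<^sup>+ \<beta> \<in> \<Delta>_dom (d - 1) \<delta>. G1_f d ft \<beta> \<partial>leb {..<d - 1}) \<and>
      1 - enn2ereal (\<integral>\<^sup>+ \<beta> \<in> \<Delta>_dom (d - 1) \<delta>. G1_f d ft \<beta> \<partial>leb {..<d - 1}) \<le> 1)"
  using m_f_bounds[of d f \<delta>] m1_f_bounds[of d ft \<delta>] assms by simp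

end
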